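(* For $n\ge5$ let $$\kappa_n=\frac{(n+1)\log\frac{1+\sqrt5}{2}-\log\frac{n+2+\sqrt{n^2+4n}}{2}}{(n-1)\log\sqrt2-\log\frac{n+2+\sqrt{n^2+4n}}{2}+2\log\frac{1+\sqrt5}{2}}.$$ (i) Let $n\ge5$ and $x\in E_n$. Suppose that for some constant $C$ and for any natural $t$ one has $$S_x(t)\le\kappa_nt+C.$$ Then $?'(x)$ exists and $?'(x)=+\infty$. (ii) Let $\psi(t)$ be an increasing function such that $\lim_{t\to+\infty}\psi(t)=+\infty$. Then for a given $n\ge5$ there exists an irrational number $x\in E_n$ such that $?'(x)$ does not exist and for any natural $t$ one has $$S_x(t)\le\kappa_nt+\psi(t).$$
   Context: The Minkowski question mark function $?:[0,1]\to[0,1]$ is the continuous increasing function defined by $?(0)=0$, $?(1)=1$, by $?\left(\frac{p+p'}{q+q'}\right)=\frac12\left(?\left(\frac pq\right)+?\left(\frac{p'}{q'}\right)\right)$ for consecutive Farey fractions $\frac pq,\frac{p'}{q'}$, and extended by continuity to irrationals. Equivalently, for irrational $x=[0;a_1,a_2,\dots]$, $?(x)=\frac1{2^{a_1-1}}-\frac1{2^{a_1+a_2-1}}+\dots+\frac{(-1)^{n+1}}{2^{a_1+\dots+a_n-1}}+\cdots$. The derivative $?'(x)$ is understood as the limit of $\frac{?(x+\delta)-?(x)}{\delta}$ as $\delta\to0$ (two-sided), and the value $+\infty$ is allowed (so "$?'(x)$ exists" means that the limit exists as a finite number or equals $+\infty$). For irrational $x\in(0,1)$ with regular continued fraction expansion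 $x=[0;a_1,a_2,\dots]$ (natural partial quotients) and natural $t$, $S_x(t)=a_1+a_2+\dots+a_t$. For an integer $n\ge2$, $E_n$ is the set of irrational $x\in(0,1)$ all of whose partial quotients satisfy $a_j\le n$, $j=1,2,3,\dots$.
   Formalization: In (ii) the condition ψ(1) ≥ 1 − κ_n is added: since S_x(1) = a_1 ≥ 1, the claimed bound at t = 1 forces it, so the claim fails for e.g. ψ(t) = t − 100. It holds for every nonnegative ψ, as κ_n > 1. *)

theory Defs
  imports "HOL-Analysis.Analysis"
begin

section \<open>The Minkowski question mark function\<close>

definition farey :: "nat \<Rightarrow> real set" where
  "farey N = {real p / real q | p q. 0 < q \<and> q \<le> N \<and> p \<le> q}"

definition consecutive_farey :: "nat \<Rightarrow> nat \<Rightarrow> nat \<Rightarrow> nat \<Rightarrow> bool" where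
  "consecutive_farey p q p' q' \<longleftrightarrow>
     0 < q \<and> 0 < q' \<and> coprime p q \<and> coprime p' q' \<and>
     (\<exists>N. real p / real q \<in> farey N \<and> real p' / real q' \<in> farey N \<and>
          real p / real q < real p' / real q' \<and>
          (\<forall>r\<in>farey N. \<not> (real p / real q < r \<and> r < real p' / real q')))"

text \<open>The membership in \<^term>\<open>extensional {0..1::real}\<close> only fixes the irrelevant values
  outside the unit interval, so that the function is unique as a total function.\<close>

definition is_question_mark :: "(real \<Rightarrow> real) \<Rightarrow> bool" where
  "is_question_mark f \<longleftrightarrow>
     f \<in> {0..1} \<rightarrow>\<^sub>E {0..1} \<and> continuous_on {0..1} f \<and> strict_mono_on {0..1} f \<and>
     f 0 = 0 \<and> f 1 = 1 \<and>
     (\<forall>p q p' q'. consecutive_farey p q p' q' \<longrightarrow>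
        f (real (p + p') / real (q + q')) = (f (real p / real q) + f (real p' / real q')) / 2)"

definition question_mark :: "real \<Rightarrow> real" where
  "question_mark = (THE f. is_question_mark f)"


subsection \<open>Existence\<close>

lemma consecutive_farey_det:
  assumes "consecutive_farey p q p' q'"
  shows "p \<le> q" "p' \<le> q'" "p' * q = p * q' + 1"
proof -
  from assms obtain N where q: "0 < q" "0 < q'" and cop: "coprime p q" "coprime p' q'"
    and inN: "real p / real q \<in> farey N" "real p' / real q' \<in> farey N"
    and lt: "real p / real q < real p' / real q'"
    and no: "\<And>r. r \<in> farey N \<Longrightarrow> \<not> (real p / real q < r \<and> r < real p' / real q')"
    unfolding consecutive_farey_def by blast
  have red: "a \<le> b \<and> b \<le> N" if "real a / real b \<in> farey N" "coprime a b" "0 < b" for a b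
  proof -
    from that(1) obtain c d where cd: "real a / real b = real c / real d" "0 < d" "d \<le> N" "c \<le> d"
      unfolding farey_def by blast
    have "real a * real d = real c * real b"
      using cd that(3) by (simp add: field_simps)
    hence eq: "a * d = c * b" by (metis of_nat_eq_iff of_nat_mult)
    hence "b dvd a * d" by simp
    hence "b dvd d" using that(2) by (simp add: coprime_commute coprime_dvd_mult_right_iff)
    hence "b \<le> d" using cd(2) by (simp add: dvd_imp_le)
    moreover have "a * d \<le> b * d" using eq cd(4) by (simp add: mult.commute)
    ultimately show ?thesis using cd(2,3) by simp
  qed
  show le: "p \<le> q" "p' \<le> q'" using red inN cop q by blast+
  have qN: "q \<le> N" "q' \<le> N" using red inN cop q by blast+
  from bezout_add_strong_nat[of q p] q(1)
  obtain d x y where d: "d dvd q" "d dvd p" "q * x = p * y + d" by blast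
  have "is_unit d" using cop(1) d(1,2) by (meson coprime_common_divisor)
  hence xy: "q * x = p * y + 1" using d(3) by simp
  have "\<exists>u v. 0 < v \<and> v \<le> N \<and> N < q + v \<and> q * u = p * v + 1"
  proof -
    define a where "a = int N - int y"
    define v where "v = int N - a mod int q"
    have vint: "v = int y + int q * (a div int q)"
      unfolding v_def a_def using mult_div_mod_eq[of "int q" "int N - int y"] by linarith
    have m: "0 \<le> a mod int q" "a mod int q < int q" using q by auto
    have v: "v \<ge> 0" "v \<le> int N" "int N < int q + v"
      unfolding v_def using m qN by linarith+
    define u where "u = int x + int p * (a div int q)"
    have eq: "int q * u = int p * v + 1"
    proof -
      have "int q * int x = int p * int y + 1" using xy by (metis of_nat_1 of_nat_add of_nat_mult)
      thus ?thesis unfolding u_def vint by (simp add: algebra_simps)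
    qed
    have pv: "int p * v \<ge> 0" using v by simp
    hence "int q * u > 0" using eq by linarith
    hence u0: "u > 0" using q by (simp add: zero_less_mult_iff)
    have eqn: "q * nat u = p * nat v + 1"
      using eq u0 v by (metis int_nat_eq less_imp_le of_nat_1 of_nat_add of_nat_eq_iff of_nat_mult)
    have "v \<noteq> 0"
    proof
      assume "v = 0"
      hence "q * nat u = 1" using eqn by simp
      hence "q = 1" by simp
      hence "int N < 1" using v \<open>v = 0\<close> by simp
      thus False using qN q by simp
    qed
    thus ?thesis using v eqn by (intro exI[of _ "nat u"] exI[of _ "nat v"]) auto
  qed
  then obtain u v where uv: "0 < v" "v \<le> N" "N < q + v" "q * u = p * v + 1" by blast
  have ltn: "p * q' < p' * q"
  proof -
    have "real p * real q' < real p' * real q" using lt q by (simp add: field_simps)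
    thus ?thesis by (metis of_nat_less_iff of_nat_mult)
  qed
  have cmp: "\<not> u * q' < p' * v"
  proof
    assume a: "u * q' < p' * v"
    have ule: "u \<le> v"
    proof (rule ccontr)
      assume "\<not> u \<le> v"
      hence "v * q' \<le> u * q'" by simp
      also have "\<dots> < p' * v" by (rule a)
      also have "\<dots> \<le> q' * v" using le by simp
      finally show False by (simp add: mult.commute)
    qed
    have mem: "real u / real v \<in> farey N" unfolding farey_def using uv ule by blast
    have "real u * real q' < real p' * real v" using a by (metis of_nat_less_iff of_nat_mult)
    hence 1: "real u / real v < real p' / real q'" using uv q by (simp add: field_simps)
    have "real q * real u = real p * real v + 1" using uv(4) by (metis of_nat_1 of_nat_add of_nat_mult)
    hence 2: "real p / real q < real u / real v" using uv q by (simp add: field_simps)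
    show False using no[OF mem] 1 2 by blast
  qed
  have "u * q' \<le> p' * v"
  proof (rule ccontr)
    assume "\<not> u * q' \<le> p' * v"
    hence "u * q' \<ge> p' * v + 1" by simp
    hence "q * (p' * v + 1) \<le> q * (u * q')" by (rule mult_le_mono2)
    also have "\<dots> = (p * v + 1) * q'" using uv(4) by (simp flip: mult.assoc)
    finally have A: "q * p' * v + q \<le> p * q' * v + q'" by (simp add: algebra_simps)
    have "(p * q' + 1) * v \<le> (p' * q) * v" using ltn by (intro mult_le_mono1) simp
    hence "p * q' * v + v \<le> q * p' * v" by (simp add: algebra_simps)
    hence "v + q \<le> q'" using A by linarith
    thus False using uv qN by linarith
  qed
  hence e: "u * q' = p' * v" using cmp by simp
  have "coprime u v"
  proof (rule coprimeI)
    fix c assume "c dvd u" "c dvd v"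
    hence "c dvd q * u" "c dvd p * v" by auto
    thus "c dvd 1" using uv(4) by (metis dvd_add_right_iff)
  qed
  have "v dvd u * q'" "q' dvd p' * v" using e by (metis dvd_triv_right dvd_triv_right)+
  hence "v dvd q'" "q' dvd v" using \<open>coprime u v\<close> cop(2)
    by (metis coprime_commute coprime_dvd_mult_right_iff)+
  hence "v = q'" by (simp add: dvd_antisym)
  moreover have "u = p'" using e q \<open>v = q'\<close> by simp
  ultimately show "p' * q = p * q' + 1" using uv(4) by (simp add: mult.commute)
qed

text \<open>The question mark function is the fixed point of
  \<open>f x = f (x / (1 - x)) / 2\<close> on \<open>[0, 1/2]\<close>, \<open>f x = 1 - f ((1 - x) / x) / 2\<close> on \<open>[1/2, 1]\<close>,
  and is obtained as a uniform limit by iterating these equations.\<close>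

primrec qm_approx :: "nat \<Rightarrow> real \<Rightarrow> real" where
  "qm_approx 0 x = x"
| "qm_approx (Suc k) x =
     (if x \<le> 1/2 then qm_approx k (x / (1 - x)) / 2 else 1 - qm_approx k ((1 - x) / x) / 2)"

lemma lower_branch: "x / (1 - x) \<in> {0..1}" if "x \<in> {0..1/2}" for x :: real
  using that by (auto simp: field_simps)

lemma upper_branch: "(1 - x) / x \<in> {0..1}" if "x \<in> {1/2..1}" for x :: real
  using that by (auto simp: field_simps)

lemma qm_approx_0_1 [simp]: "qm_approx k 0 = 0" "qm_approx k 1 = 1"
proof -
  have "qm_approx k 0 = 0 \<and> qm_approx k 1 = 1" by (induction k) auto
  thus "qm_approx k 0 = 0" "qm_approx k 1 = 1" by auto
qed

lemma qm_approx_upper: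
  "x \<in> {1/2..1} \<Longrightarrow> qm_approx (Suc k) x = 1 - qm_approx k ((1 - x) / x) / 2"
proof (cases "x = 1/2")
  case True
  show ?thesis unfolding True by simp
qed auto

lemma qm_approx_range: "x \<in> {0..1} \<Longrightarrow> qm_approx k x \<in> {0..1}"
proof (induction k arbitrary: x)
  case (Suc k)
  show ?case
  proof (cases "x \<le> 1/2")
    case True
    thus ?thesis using Suc.IH[OF lower_branch[of x]] Suc.prems by auto
  next
    case False
    thus ?thesis using Suc.IH[OF upper_branch[of x]] Suc.prems by auto
  qed
qed auto

lemma qm_approx_continuous: "continuous_on {0..1} (qm_approx k)"
proof (induction k)
  case 0
  show ?case by (simp add: continuous_on_id)
next
  case (Suc k)
  have 1: "continuous_on {0..1/2} (\<lambda>x. qm_approx k (x / (1 - x)) / 2)"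
    by (intro continuous_intros continuous_on_compose2[OF Suc.IH])
       (use lower_branch in \<open>auto\<close>)
  have 2: "continuous_on {1/2..1} (\<lambda>x. 1 - qm_approx k ((1 - x) / x) / 2)"
    by (intro continuous_intros continuous_on_compose2[OF Suc.IH])
       (use upper_branch in \<open>auto\<close>)
  have "continuous_on ({0..1/2} \<union> {1/2..1}) (qm_approx (Suc k))"
  proof (rule continuous_on_closed_Un)
    show "continuous_on {0..1/2} (qm_approx (Suc k))"
      using 1 by (rule continuous_on_cong[THEN iffD1, rotated -1]) auto
    show "continuous_on {1/2..1} (qm_approx (Suc k))"
      using 2 by (rule continuous_on_cong[THEN iffD1, rotated -1]) (auto simp: qm_approx_upper simp del: qm_approx.simps)
  qed auto
  moreover have "{0..1/2} \<union> {1/2..1} = {0..1::real}" by auto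
  ultimately show ?case by simp
qed

lemma qm_approx_mono: "0 \<le> x \<Longrightarrow> x \<le> y \<Longrightarrow> y \<le> 1 \<Longrightarrow> qm_approx k x \<le> qm_approx k y"
proof (induction k arbitrary: x y)
  case (Suc k)
  consider "y \<le> 1/2" | "x \<le> 1/2" "y > 1/2" | "x > 1/2" by linarith
  thus ?case
  proof cases
    case 1
    have "x / (1 - x) \<le> y / (1 - y)" using 1 Suc.prems by (intro frac_le) auto
    thus ?thesis
      using Suc.IH[of "x / (1 - x)" "y / (1 - y)"] 1 Suc.prems lower_branch[of x] lower_branch[of y]
      by auto
  next
    case 2
    thus ?thesis
      using Suc.prems qm_approx_range[OF lower_branch[of x], of k]
        qm_approx_range[OF upper_branch[of y], of k] by auto
  next
    case 3
    have "(1 - y) / y \<le> (1 - x) / x" using 3 Suc.prems by (intro frac_le) auto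
    thus ?thesis
      using Suc.IH[of "(1 - y) / y" "(1 - x) / x"] 3 Suc.prems upper_branch[of x] upper_branch[of y]
      by auto
  qed
qed auto

lemma qm_approx_diff:
  "x \<in> {0..1} \<Longrightarrow> \<bar>qm_approx (Suc k) x - qm_approx k x\<bar> \<le> (1/2) ^ k"
proof (induction k arbitrary: x)
  case 0
  have "qm_approx (Suc 0) x \<in> {0..1}" "qm_approx 0 x \<in> {0..1}" using 0 by (blast intro: qm_approx_range)+
  thus ?case by (simp add: abs_le_iff del: qm_approx.simps)
next
  case (Suc k)
  show ?case
  proof (cases "x \<le> 1/2")
    case True
    have rec: "qm_approx (Suc j) x = qm_approx j (x / (1 - x)) / 2" for j using True by simp
    have eq: "qm_approx (Suc (Suc k)) x - qm_approx (Suc k) x =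
        (qm_approx (Suc k) (x / (1 - x)) - qm_approx k (x / (1 - x))) / 2"
      by (simp only: rec diff_divide_distrib)
    show ?thesis using Suc.IH[OF lower_branch[of x]] True Suc.prems unfolding eq by (simp del: qm_approx.simps)
  next
    case False
    have rec: "qm_approx (Suc j) x = 1 - qm_approx j ((1 - x) / x) / 2" for j using False by simp
    have eq: "qm_approx (Suc (Suc k)) x - qm_approx (Suc k) x =
        - (qm_approx (Suc k) ((1 - x) / x) - qm_approx k ((1 - x) / x)) / 2"
      unfolding rec by (simp add: diff_divide_distrib del: qm_approx.simps)
    show ?thesis using Suc.IH[OF upper_branch[of x]] False Suc.prems unfolding eq by (simp del: qm_approx.simps)
  qed
qed

lemma qm_limit_exists:
  obtains f where "continuous_on {0..1} f" "f 0 = 0" "f (1::real) = (1::real)"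
    "\<And>x. x \<in> {0..1} \<Longrightarrow> f x \<in> {0..1}"
    "\<And>x y. 0 \<le> x \<Longrightarrow> x \<le> y \<Longrightarrow> y \<le> 1 \<Longrightarrow> f x \<le> f y"
    "\<And>x. x \<in> {0..1/2} \<Longrightarrow> f x = f (x / (1 - x)) / 2"
    "\<And>x. x \<in> {1/2..1} \<Longrightarrow> f x = 1 - f ((1 - x) / x) / 2"
proof -
  define d where "d = (\<lambda>k x. qm_approx (Suc k) x - qm_approx k x)"
  define f where "f = (\<lambda>x. x + (\<Sum>k. d k x))"
  have tele: "qm_approx n x = x + (\<Sum>k<n. d k x)" for n x
    by (induction n) (auto simp: d_def simp del: qm_approx.simps(2))
  have "uniform_limit {0..1} (\<lambda>n x. \<Sum>k<n. d k x) (\<lambda>x. \<Sum>k. d k x) sequentially"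
    by (rule Weierstrass_m_test[where M = "\<lambda>k. (1/2) ^ k"])
       (use qm_approx_diff in \<open>auto simp: d_def summable_geometric simp del: qm_approx.simps\<close>)
  hence U: "uniform_limit {0..1} qm_approx f sequentially"
    unfolding f_def uniform_limit_iff by (simp add: tele dist_real_def)
  have L: "(\<lambda>k. qm_approx k x) \<longlonglongrightarrow> f x" if "x \<in> {0..1}" for x
    using tendsto_uniform_limitI[OF U that] .
  show ?thesis
  proof
    show "continuous_on {0..1} f"
      by (rule uniform_limit_theorem[OF _ U]) (auto simp: qm_approx_continuous)
    show "f 0 = 0" using LIMSEQ_unique[OF L[of 0]] by simp
    show "f 1 = 1" using LIMSEQ_unique[OF L[of 1]] by simp
    show "f x \<in> {0..1}" if "x \<in> {0..1}" for x
      using closed_sequentially[OF _ _ L[OF that], of "{0..1}"] qm_approx_range[OF that] by auto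
    show "f x \<le> f y" if "0 \<le> x" "x \<le> y" "y \<le> 1" for x y
      by (rule LIMSEQ_le[OF L L]) (use that qm_approx_mono[OF that] in auto)
    show "f x = f (x / (1 - x)) / 2" if x: "x \<in> {0..1/2}" for x
    proof -
      have "(\<lambda>k. qm_approx (Suc k) x) \<longlonglongrightarrow> f x" using x by (intro LIMSEQ_Suc L) auto
      moreover have "(\<lambda>k. qm_approx (Suc k) x) \<longlonglongrightarrow> f (x / (1 - x)) / 2"
        using x tendsto_divide[OF L[OF lower_branch[OF x]] tendsto_const[of 2]] by auto
      ultimately show ?thesis using LIMSEQ_unique by blast
    qed
    show "f x = 1 - f ((1 - x) / x) / 2" if x: "x \<in> {1/2..1}" for x
    proof -
      have "(\<lambda>k. qm_approx (Suc k) x) \<longlonglongrightarrow> f x" using x by (intro LIMSEQ_Suc L) auto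
      moreover have "(\<lambda>k. qm_approx (Suc k) x) \<longlonglongrightarrow> 1 - f ((1 - x) / x) / 2"
        unfolding qm_approx_upper[OF x] by (intro tendsto_intros L upper_branch x) auto
      ultimately show ?thesis using LIMSEQ_unique by blast
    qed
  qed
qed

lemma frac_lower:
  assumes "2 * p \<le> q" "0 < q"
  shows "real p / real q \<in> {0..1/2}"
    "(real p / real q) / (1 - real p / real q) = real p / real (q - p)"
proof -
  have "real (2 * p) \<le> real q" using assms(1) by (rule of_nat_mono)
  hence a: "2 * real p \<le> real q" by simp
  thus "real p / real q \<in> {0..1/2}" using assms(2) by (simp add: field_simps)
  have b: "real (q - p) = real q - real p" using assms by (simp add: of_nat_diff)
  show "(real p / real q) / (1 - real p / real q) = real p / real (q - p)"
    unfolding b using assms(2) a by (simp add: divide_simps)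
qed

lemma frac_upper:
  assumes "q \<le> 2 * p" "p \<le> q" "0 < q"
  shows "real p / real q \<in> {1/2..1}"
    "(1 - real p / real q) / (real p / real q) = real (q - p) / real p"
proof -
  have "real q \<le> real (2 * p)" using assms(1) by (rule of_nat_mono)
  hence a: "real q \<le> 2 * real p" by simp
  thus "real p / real q \<in> {1/2..1}" using assms by (simp add: field_simps)
  have b: "real (q - p) = real q - real p" using assms by (simp add: of_nat_diff)
  show "(1 - real p / real q) / (real p / real q) = real (q - p) / real p"
    unfolding b using assms a by (simp add: divide_simps)
qed

context
  fixes f :: "real \<Rightarrow> real"
  assumes f0: "f 0 = 0" and f1: "f 1 = 1"
    and frange: "\<And>x. x \<in> {0..1} \<Longrightarrow> f x \<in> {0..1}"
    and flow: "\<And>x. x \<in> {0..1/2} \<Longrightarrow> f x = f (x / (1 - x)) / 2"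
    and fupp: "\<And>x. x \<in> {1/2..1} \<Longrightarrow> f x = 1 - f ((1 - x) / x) / 2"
begin

lemma flow_frac:
  "2 * p \<le> q \<Longrightarrow> 0 < q \<Longrightarrow> f (real p / real q) = f (real p / real (q - p)) / 2"
  using flow[OF frac_lower(1)] frac_lower(2) by metis

lemma fupp_frac:
  "q \<le> 2 * p \<Longrightarrow> p \<le> q \<Longrightarrow> 0 < q \<Longrightarrow> f (real p / real q) = 1 - f (real (q - p) / real p) / 2"
  using fupp[OF frac_upper(1)] frac_upper(2) by metis

lemma frange_frac: "p \<le> q \<Longrightarrow> 0 < q \<Longrightarrow> 0 \<le> f (real p / real q) \<and> f (real p / real q) \<le> 1"
  using frange[of "real p / real q"] by simp

lemma f_less_frac:
  "\<lbrakk>0 < q; 0 < q'; p \<le> q; p' \<le> q'; p * q' < p' * q\<rbrakk>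
     \<Longrightarrow> f (real p / real q) < f (real p' / real q')"
proof (induction "q + q'" arbitrary: p q p' q' rule: less_induct)
  case less
  note A = less.prems
  have p'0: "0 < p'" using A(5) by (cases p') auto
  have pq: "p < q"
  proof (rule ccontr)
    assume "\<not> p < q"
    hence "p = q" using A by simp
    thus False using A by simp
  qed
  consider "2 * p' \<le> q'" | "q \<le> 2 * p" | "2 * p < q" "q' < 2 * p'" by linarith
  thus ?case
  proof cases
    case 1
    have "2 * p * q' < q * q'"
    proof -
      have "2 * (p * q') < 2 * (p' * q)" using A(5) by simp
      also have "\<dots> = (2 * p') * q" by simp
      also have "\<dots> \<le> q' * q" using 1 by (rule mult_le_mono1)
      finally show ?thesis by (simp add: mult_ac)
    qed
    hence 2: "2 * p \<le> q" using A by simp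
    have "p * (q' - p') < p' * (q - p)"
      using A(5) by (simp add: diff_mult_distrib2 mult.commute diff_less_mono 1 2)
        (metis 1 p'0 A(2) diff_less_mono le_trans mult.commute mult_le_mono2 mult_2 le_add1)
    hence "f (real p / real (q - p)) < f (real p' / real (q' - p'))"
      using A 1 2 p'0 pq by (intro less.hyps) auto
    thus ?thesis using flow_frac[OF 1 A(2)] flow_frac[OF 2 A(1)] by simp
  next
    case 2
    have p0: "0 < p" using 2 A by linarith
    have "q * q' < 2 * p' * q"
    proof -
      have "q * q' \<le> (2 * p) * q'" using 2 by (rule mult_le_mono1)
      also have "\<dots> < 2 * (p' * q)" using A(5) by simp
      finally show ?thesis by simp
    qed
    hence 3: "q' \<le> 2 * p'" using A by (simp add: mult.commute)
    have "(q' - p') * p < (q - p) * p'"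
    proof -
      have "int p * int q' < int p' * int q" using A(5) by (metis of_nat_less_iff of_nat_mult)
      hence "int ((q' - p') * p) < int ((q - p) * p')" using A by (simp add: of_nat_diff algebra_simps)
      thus ?thesis by (simp only: of_nat_less_iff)
    qed
    hence "f (real (q' - p') / real p') < f (real (q - p) / real p)"
      using A 2 3 p'0 p0 pq by (intro less.hyps) auto
    thus ?thesis using fupp_frac[OF 3 A(4,2)] fupp_frac[OF 2 A(3,1)] by simp
  next
    case 3
    have "f (real p / real q) < 1/2"
    proof (cases "p = 0")
      case True thus ?thesis using f0 by simp
    next
      case False
      have "f (real p / real (q - p)) < f (real 1 / real 1)"
        using A 3 pq False by (intro less.hyps) auto
      thus ?thesis using flow_frac[of p q] 3 A f1 by simp
    qed
    also have "\<dots> \<le> f (real p' / real q')"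
      using fupp_frac[of q' p'] frange_frac[of "q' - p'" p'] 3 A p'0 by simp
    finally show ?thesis .
  qed
qed

lemma f_mediant:
  "\<lbrakk>0 < q; 0 < q'; p \<le> q; p' \<le> q'; p' * q = p * q' + 1\<rbrakk>
     \<Longrightarrow> f (real (p + p') / real (q + q')) = (f (real p / real q) + f (real p' / real q')) / 2"
proof (induction "q + q'" arbitrary: p q p' q' rule: less_induct)
  case less
  note A = less.prems
  have p'0: "0 < p'" using A(5) by (cases p') auto
  have pq: "p < q"
  proof (rule ccontr)
    assume "\<not> p < q"
    hence "p = q" using A by simp
    hence "q * p' = q * q' + 1" using A by (simp add: mult.commute)
    moreover have "q * p' \<le> q * q'" using A by simp
    ultimately show False by simp
  qed
  have I: "int p' * int q = int p * int q' + 1"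
    using A(5) by (metis of_nat_1 of_nat_add of_nat_mult)
  consider "2 * p' \<le> q'" | "q \<le> 2 * p" | "2 * p < q" "q' < 2 * p'" by linarith
  thus ?case
  proof cases
    case 1
    have "2 * p * q' < q * q'"
    proof -
      have "2 * (p * q') < 2 * (p' * q)" using A(5) by simp
      also have "\<dots> = (2 * p') * q" by simp
      also have "\<dots> \<le> q' * q" using 1 by (rule mult_le_mono1)
      finally show ?thesis by (simp add: mult_ac)
    qed
    hence 2: "2 * p \<le> q" using A by simp
    have "int (p' * (q - p)) = int (p * (q' - p') + 1)"
      unfolding of_nat_mult of_nat_add of_nat_1 of_nat_diff[OF A(3)] of_nat_diff[OF A(4)]
      using I by (simp add: algebra_simps)
    hence "p' * (q - p) = p * (q' - p') + 1" by (simp only: of_nat_eq_iff)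
    hence "f (real (p + p') / real ((q - p) + (q' - p'))) =
        (f (real p / real (q - p)) + f (real p' / real (q' - p'))) / 2"
      using A 1 2 p'0 pq by (intro less.hyps) auto
    moreover have "(q - p) + (q' - p') = (q + q') - (p + p')" using A by simp
    moreover have "f (real (p + p') / real (q + q')) = f (real (p + p') / real ((q + q') - (p + p'))) / 2"
      using A 1 2 by (intro flow_frac) auto
    ultimately show ?thesis using flow_frac[OF 1 A(2)] flow_frac[OF 2 A(1)] by simp
  next
    case 2
    have p0: "0 < p" using 2 A by linarith
    have "q * q' < 2 * p' * q"
    proof -
      have "q * q' \<le> (2 * p) * q'" using 2 by (rule mult_le_mono1)
      also have "\<dots> < 2 * (p' * q)" using A(5) by simp
      finally show ?thesis by simp
    qed
    hence 3: "q' \<le> 2 * p'" using A by (simp add: mult.commute)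
    have "int ((q - p) * p') = int ((q' - p') * p + 1)"
      unfolding of_nat_mult of_nat_add of_nat_1 of_nat_diff[OF A(3)] of_nat_diff[OF A(4)]
      using I by (simp add: algebra_simps)
    hence "(q - p) * p' = (q' - p') * p + 1" by (simp only: of_nat_eq_iff)
    hence "f (real ((q' - p') + (q - p)) / real (p' + p)) =
        (f (real (q' - p') / real p') + f (real (q - p) / real p)) / 2"
      using A 2 3 p'0 p0 pq by (intro less.hyps) auto
    moreover have "(q' - p') + (q - p) = (q + q') - (p + p')" using A by simp
    moreover have "f (real (p + p') / real (q + q')) =
        1 - f (real ((q + q') - (p + p')) / real (p + p')) / 2"
      using A 2 3 by (intro fupp_frac) auto
    ultimately show ?thesis using fupp_frac[OF 3 A(4,2)] fupp_frac[OF 2 A(3,1)]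
      by (simp add: add.commute field_simps)
  next
    case 3
    have "(q' + 1) * q \<le> (2 * p') * q" using 3 by (intro mult_le_mono1) simp
    moreover have "(2 * p + 1) * q' \<le> q * q'" using 3 by (intro mult_le_mono1) simp
    ultimately have "q + q' \<le> 2" using A(5) by (simp add: algebra_simps)
    hence q: "q = 1" "q' = 1" using A by auto
    have p: "p = 0" "p' = 1" using q A by auto
    have "f (real 1 / real 2) = f (real 1 / real (2 - 1)) / 2" by (rule flow_frac) auto
    thus ?thesis using p q f0 f1 by simp
  qed
qed

end

lemma ex_question_mark: "\<exists>f. is_question_mark f"
proof -
  obtain f where cont: "continuous_on {0..1} f" and f0: "f 0 = 0" and f1: "f (1::real) = (1::real)"
    and range: "\<And>x. x \<in> {0..1} \<Longrightarrow> f x \<in> {0..1}"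
    and mono: "\<And>x y. 0 \<le> x \<Longrightarrow> x \<le> y \<Longrightarrow> y \<le> 1 \<Longrightarrow> f x \<le> f y"
    and low: "\<And>x. x \<in> {0..1/2} \<Longrightarrow> f x = f (x / (1 - x)) / 2"
    and upp: "\<And>x. x \<in> {1/2..1} \<Longrightarrow> f x = 1 - f ((1 - x) / x) / 2"
    by (rule qm_limit_exists) (rule that)
  have less: "f x < f y" if xy: "x \<in> {0..1}" "y \<in> {0..1}" "x < y" for x y
  proof -
    obtain r where r: "r \<in> \<rat>" "x < r" "r < y" using Rats_dense_in_real[OF xy(3)] by blast
    obtain s where s: "s \<in> \<rat>" "r < s" "s < y" using Rats_dense_in_real[OF r(3)] by blast
    obtain a b where ab: "b \<noteq> 0" "\<bar>r\<bar> = real a / real b" by (rule Rats_abs_nat_div_natE[OF r(1)])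
    obtain c d where cd: "d \<noteq> 0" "\<bar>s\<bar> = real c / real d" by (rule Rats_abs_nat_div_natE[OF s(1)])
    have rs: "r = real a / real b" "s = real c / real d" using ab cd r s xy by auto
    have "real a / real b < 1" "real c / real d < 1" "real a / real b < real c / real d"
      using rs r s xy by auto
    hence n: "real a \<le> real b" "real c \<le> real d" "real a * real d < real c * real b"
      using ab cd by (auto simp: field_simps)
    have "a * d < c * b" using n(3) by (metis of_nat_less_iff of_nat_mult)
    hence "f r < f s" unfolding rs
      using n ab cd by (intro f_less_frac[of f, OF f0 f1 range low upp]) auto
    moreover have "f x \<le> f r" "f s \<le> f y" using r s xy by (auto intro!: mono)
    ultimately show ?thesis by linarith
  qed
  define g where "g = restrict f {0..1}"
  have g: "g x = f x" if "x \<in> {0..1}" for x using that by (simp add: g_def)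
  have gf: "g (real p / real q) = f (real p / real q)" if "p \<le> q" "0 < q" for p q
    using that by (intro g) auto
  have "is_question_mark g"
    unfolding is_question_mark_def
  proof (intro conjI allI impI)
    show "g \<in> {0..1} \<rightarrow>\<^sub>E {0..1}" using range by (auto simp: g_def)
    show "continuous_on {0..1} g" using cont by (rule continuous_on_cong[THEN iffD1, rotated -1]) (auto simp: g)
    show "strict_mono_on {0..1} g" using less by (auto simp: strict_mono_on_def g)
    show "g 0 = 0" "g 1 = 1" using f0 f1 by (auto simp: g)
    fix p q p' q' assume *: "consecutive_farey p q p' q'"
    note d = consecutive_farey_det[OF *]
    have q: "0 < q" "0 < q'" using * by (auto simp: consecutive_farey_def)
    have "f (real (p + p') / real (q + q')) = (f (real p / real q) + f (real p' / real q')) / 2"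
      using q d by (intro f_mediant[of f, OF f0 f1 range low upp]) auto
    thus "g (real (p + p') / real (q + q')) = (g (real p / real q) + g (real p' / real q')) / 2"
      using d q by (subst (1 2 3) gf) auto
  qed
  thus ?thesis by blast
qed


subsection \<open>Uniqueness\<close>

lemma det_consecutive_farey:
  assumes "0 < q" "0 < q'" "p \<le> q" "p' \<le> q'" "p' * q = p * q' + 1"
  shows "consecutive_farey p q p' q'"
proof -
  have c: "coprime p q" "coprime p' q'"
    using assms(5) by (metis coprimeI dvd_add_right_iff dvd_mult dvd_mult2 mult.commute)+
  have I: "int p' * int q = int p * int q' + 1"
    using assms(5) by (metis of_nat_1 of_nat_add of_nat_mult)
  hence R: "real p' * real q = real p * real q' + 1"
    using assms(5) by (metis of_nat_1 of_nat_add of_nat_mult)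
  have no: "\<not> (real p / real q < r \<and> r < real p' / real q')" if r: "r \<in> farey (max q q')" for r
  proof
    assume h: "real p / real q < r \<and> r < real p' / real q'"
    obtain a b where ab: "r = real a / real b" "0 < b" "b \<le> max q q'"
      using r unfolding farey_def by blast
    have "real p * real b < real a * real q" "real a * real q' < real p' * real b"
      using h ab assms by (auto simp: field_simps)
    hence "p * b < a * q" "a * q' < p' * b" by (metis of_nat_less_iff of_nat_mult)+
    hence "int p * int b < int a * int q" "int a * int q' < int p' * int b"
      by (metis of_nat_less_iff of_nat_mult)+
    hence "1 \<le> int a * int q - int p * int b" "1 \<le> int p' * int b - int a * int q'" by linarith+
    hence "int q' * 1 + int q * 1 \<le> int q' * (int a * int q - int p * int b)
        + int q * (int p' * int b - int a * int q')"
      by (intro add_mono mult_left_mono) auto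
    also have "\<dots> = int b * (int p' * int q - int p * int q')" by (simp add: algebra_simps)
    also have "\<dots> = int b" using I by simp
    finally show False using ab assms by linarith
  qed
  have mem: "real a / real b \<in> farey N" if "0 < b" "b \<le> N" "a \<le> b" for a b N
    unfolding farey_def using that by blast
  have "real p / real q < real p' / real q'" using R assms by (simp add: field_simps)
  moreover have "real p / real q \<in> farey (max q q')" "real p' / real q' \<in> farey (max q q')"
    using mem[of q _ p] mem[of q' _ p'] assms by simp_all
  ultimately show ?thesis unfolding consecutive_farey_def using assms c no by blast
qed

lemma question_mark_agree_Rats:
  assumes "is_question_mark f" "is_question_mark g"
  shows "\<lbrakk>0 < q; p \<le> q; coprime p q\<rbrakk> \<Longrightarrow> f (real p / real q) = g (real p / real q)"
proof (induction q arbitrary: p rule: less_induct)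
  case (less q)
  show ?case
  proof (cases "q = 1")
    case True
    hence "p = 0 \<or> p = 1" using less.prems by auto
    thus ?thesis using assms True by (auto simp: is_question_mark_def)
  next
    case False
    hence q: "2 \<le> q" using less.prems by simp
    have p0: "0 < p" using less.prems False by (cases p) auto
    have pq: "p < q" using less.prems False by (cases "p = q") auto
    from bezout_add_strong_nat[of p q] p0
    obtain d x y where d: "d dvd p" "d dvd q" "p * x = q * y + d" by blast
    have "is_unit d" using less.prems(3) d(1,2) by (meson coprime_common_divisor)
    hence xy: "p * x = q * y + 1" using d(3) by simp
    define v where "v = x mod q"
    define k where "k = x div q"
    have x: "x = q * k + v" by (simp add: v_def k_def)
    have vq: "v < q" using q by (simp add: v_def)
    have "q dvd p * v - 1 \<and> 0 < v"
    proof -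
      have I: "int p * int x = int q * int y + 1" using xy by (metis of_nat_1 of_nat_add of_nat_mult)
      hence "int p * int v - 1 = int q * (int y - int p * int k)" unfolding x by (simp add: algebra_simps)
      hence d: "int q dvd int p * int v - 1" by simp
      have "v \<noteq> 0"
      proof
        assume "v = 0"
        hence "int q dvd 1" using d by simp
        thus False using q by simp
      qed
      hence "int p * int v - 1 = int (p * v - 1)" using p0 by (simp add: of_nat_diff Suc_le_eq)
      thus ?thesis using d \<open>v \<noteq> 0\<close> by (simp only: int_dvd_int_iff) simp
    qed
    then obtain u where v0: "0 < v" and "p * v - 1 = q * u" by auto
    hence uv: "p * v = q * u + 1" using p0 v0 by (metis Suc_eq_plus1 Suc_diff_1 nat_0_less_mult_iff)
    have uv1: "u \<le> v"
    proof (rule ccontr)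
      assume "\<not> u \<le> v"
      hence "p * v \<le> q * u" using pq by (intro mult_le_mono) auto
      thus False using uv by simp
    qed
    have up: "u < p"
    proof (rule ccontr)
      assume "\<not> u < p"
      hence "v * p \<le> q * u" using vq by (intro mult_le_mono) auto
      thus False using uv by (simp add: mult.commute)
    qed
    have I: "int p * int v = int q * int u + 1" using uv by (metis of_nat_1 of_nat_add of_nat_mult)
    have "p - u \<le> q - v"
    proof (rule ccontr)
      assume "\<not> p - u \<le> q - v"
      hence "int p - int u \<ge> int q - int v + 1" using up vq by linarith
      hence "int v * (int q - int v + 1) \<le> int v * (int p - int u)" by (intro mult_left_mono) auto
      also have "\<dots> = int u * (int q - int v) + 1" using I by (simp add: algebra_simps)
      also have "\<dots> \<le> int v * (int q - int v) + 1" using uv1 vq by (intro add_right_mono mult_right_mono) auto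
      finally have "int v \<le> 1" by (simp add: algebra_simps)
      hence "v = 1" using v0 by simp
      hence "p = q * u + 1" using uv by simp
      hence "u = 0" using pq by (cases u) auto
      thus False using \<open>\<not> p - u \<le> q - v\<close> \<open>p = q * u + 1\<close> vq \<open>v = 1\<close> by simp
    qed
    moreover have "(p - u) * v = u * (q - v) + 1"
    proof -
      have "int ((p - u) * v) = int (u * (q - v) + 1)"
        unfolding of_nat_mult of_nat_add of_nat_1 of_nat_diff[OF less_imp_le[OF up]]
          of_nat_diff[OF less_imp_le[OF vq]]
        using I by (simp add: algebra_simps)
      thus ?thesis by (simp only: of_nat_eq_iff)
    qed
    ultimately have cf: "consecutive_farey u v (p - u) (q - v)"
      using v0 vq uv1 by (intro det_consecutive_farey) auto
    hence c: "coprime u v" "coprime (p - u) (q - v)" by (auto simp: consecutive_farey_def)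
    have H: "h (real p / real q) = (h (real u / real v) + h (real (p - u) / real (q - v))) / 2"
      if "is_question_mark h" for h
    proof -
      have "h (real (u + (p - u)) / real (v + (q - v))) =
          (h (real u / real v) + h (real (p - u) / real (q - v))) / 2"
        using that cf unfolding is_question_mark_def by blast
      thus ?thesis using up vq by simp
    qed
    moreover have "f (real u / real v) = g (real u / real v)"
      using c v0 uv1 vq by (intro less.IH) auto
    moreover have "f (real (p - u) / real (q - v)) = g (real (p - u) / real (q - v))"
      using c v0 \<open>p - u \<le> q - v\<close> vq by (intro less.IH) auto
    ultimately show ?thesis using H[OF assms(1)] H[OF assms(2)] by simp
  qed
qed

lemma question_mark_unique:
  assumes "is_question_mark f" "is_question_mark g"
  shows "f = g"
proof
  fix x
  show "f x = g x"
  proof (cases "x \<in> {0..1}")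
    case False
    thus ?thesis using assms unfolding is_question_mark_def by (metis PiE_arb)
  next
    case True
    have ends: "f 0 = g 0" "f 1 = g 1" using assms by (auto simp: is_question_mark_def)
    show ?thesis
    proof (cases "x = 0 \<or> x = 1")
      case True thus ?thesis using ends by auto
    next
      case False
      hence x: "x \<in> {0<..<1}" using True by auto
      have cont: "continuous_on {0<..<1} (\<lambda>x. f x - g x)"
        using assms unfolding is_question_mark_def
        by (intro continuous_intros) (auto elim: continuous_on_subset)
      have rat: "f r - g r = 0" if ir: "r \<in> \<rat>" "r \<in> {0<..<1}" for r
      proof -
        obtain a b where ab: "b \<noteq> 0" "\<bar>r\<bar> = real a / real b" "coprime a b"
          by (rule Rats_abs_nat_div_natE[OF ir(1)])
        hence r: "r = real a / real b" using that by auto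
        have "a \<le> b" using that r ab by (auto simp: field_simps)
        thus ?thesis using question_mark_agree_Rats[OF assms, of b a] ab r by simp
      qed
      show ?thesis
      proof (rule ccontr)
        assume "f x \<noteq> g x"
        hence "x \<in> {0<..<1} \<inter> (\<lambda>x. f x - g x) -` (- {0})" using x by simp
        moreover have "open ({0<..<1} \<inter> (\<lambda>x. f x - g x) -` (- {0}))"
          using cont by (rule continuous_open_preimage) auto
        ultimately obtain e where e: "e > 0" "ball x e \<subseteq> {0<..<1} \<inter> (\<lambda>x. f x - g x) -` (- {0})"
          by (meson openE)
        obtain r where r: "r \<in> \<rat>" "x < r" "r < x + e" using Rats_dense_in_real[of x "x + e"] e by auto
        hence "r \<in> ball x e" by (auto simp: dist_real_def)
        hence "r \<in> {0<..<1}" "f r - g r \<noteq> 0" using e(2) by auto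
        thus False using rat r by blast
      qed
    qed
  qed
qed

lemma is_question_mark_question_mark: "is_question_mark question_mark"
  unfolding question_mark_def
  using ex_question_mark question_mark_unique by (metis theI)


section \<open>Two-sided derivatives with infinite values allowed\<close>

definition has_extended_derivative :: "(real \<Rightarrow> real) \<Rightarrow> real \<Rightarrow> ereal \<Rightarrow> bool" where
  "has_extended_derivative f x l \<longleftrightarrow> ((\<lambda>\<delta>. ereal ((f (x + \<delta>) - f x) / \<delta>)) \<longlongrightarrow> l) (at 0)"

definition extended_differentiable :: "(real \<Rightarrow> real) \<Rightarrow> real \<Rightarrow> bool" where
  "extended_differentiable f x \<longleftrightarrow> (\<exists>l. l \<noteq> -\<infinity> \<and> has_extended_derivative f x l)"


section \<open>Regular continued fractions\<close>

definition gauss_map :: "real \<Rightarrow> real" where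
  "gauss_map x = frac (1 / x)"

text \<open>Indices start at \<open>1\<close>: the \<open>j\<close>-th partial quotient of an irrational \<open>x = [0; a\<^sub>1, a\<^sub>2, \<dots>]\<close> is
  \<open>partial_quotient x j = a\<^sub>j\<close> (the value at \<open>j = 0\<close> carries no meaning).\<close>

definition partial_quotient :: "real \<Rightarrow> nat \<Rightarrow> nat" where
  "partial_quotient x j = nat \<lfloor>1 / (gauss_map ^^ (j - 1)) x\<rfloor>"

definition quotient_sum :: "real \<Rightarrow> nat \<Rightarrow> nat" where
  "quotient_sum x t = (\<Sum>j=1..t. partial_quotient x j)"

definition bounded_quotients :: "nat \<Rightarrow> real set" where
  "bounded_quotients n = {x \<in> {0<..<1}. x \<notin> \<rat> \<and> (\<forall>j\<ge>1. partial_quotient x j \<le> n)}"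

definition kappa :: "nat \<Rightarrow> real" where
  "kappa n =
     ((real n + 1) * ln ((1 + sqrt 5) / 2) - ln ((real n + 2 + sqrt (real n ^ 2 + 4 * real n)) / 2)) /
     ((real n - 1) * ln (sqrt 2) - ln ((real n + 2 + sqrt (real n ^ 2 + 4 * real n)) / 2)
        + 2 * ln ((1 + sqrt 5) / 2))"

end

theory Submission
  imports Defs
begin

text \<open>
  Let \<open>q\<^sub>t\<close> be the denominators of the convergents of \<open>x\<close>. If the partial quotients are bounded, then
  the difference quotients of the question mark function at \<open>x\<close> are comparable, up to constant
  factors, to the ratios \<open>q\<^sub>t\<^sup>2 / 2 ^ S\<^sub>x(t)\<close>: on one side \<open>|?(p\<^sub>t/q\<^sub>t) - ?(x)|\<close> is of order
  \<open>2 ^ - S\<^sub>x(t)\<close> while \<open>|p\<^sub>t/q\<^sub>t - x|\<close> is of order \<open>1 / q\<^sub>t\<^sup>2\<close>, and on the other side every small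
  interval \<open>[x, x + \<delta>]\<close> contains a convergent whose second predecessor lies outside.

  Among the sequences with entries in \<open>{1..n}\<close>, the slowest growth of \<open>q\<^sub>t\<close> for a given \<open>S\<^sub>x(t)\<close> is
  attained by concatenating long blocks \<open>1, 1, \<dots>\<close> and \<open>1, n, 1, n, \<dots>\<close>. This is seen by giving an
  entry \<open>k\<close> a weight which is exponential in \<open>k\<close> and makes both blocks neutral: the minimum of two
  linear functionals of \<open>(q\<^sub>t, q\<^sub>t\<^sub>-\<^sub>1)\<close>, divided by the weights of the entries used, never decreases,
  and it gains a fixed factor at an entry \<open>2, \<dots>, n - 1\<close> and at \<open>n, n\<close> and \<open>n, 1, 1\<close>. The
  constant \<open>kappa n\<close> is the value for which the weights turn \<open>S\<^sub>x(t) \<le> kappa n * t + C\<close> into a lower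
  bound for the ratio. Either infinitely many gains occur, or the sequence is finally \<open>1, 1, \<dots>\<close>, where the
  ratio grows anyway, or finally \<open>1, n, 1, n, \<dots>\<close>, which violates the bound since
  \<open>2 * kappa n < n + 1\<close>.

  For the second part, alternate very long blocks of ones, which make the ratio large, with blocks
  \<open>1, n, 1, n, \<dots>\<close> continued until \<open>S\<^sub>x(t) - kappa n * t\<close> is large enough to bring the ratio
  below \<open>1\<close>; the required excess depends only on the sequence before the block of ones, so \<open>\<psi>\<close>
  exceeds it once that block is long enough.
\<close>

section \<open>Continued fraction expansions\<close>

lemma gauss_map_irrational:
  assumes "x \<in> {0<..<1}" "x \<notin> \<rat>"
  shows "gauss_map x \<in> {0<..<1}" "gauss_map x \<notin> \<rat>"
proof -
  have "1 / x \<notin> \<rat>"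
    using assms(2) by (metis Rats_divide Rats_1 divide_divide_eq_right div_by_1 mult_1)
  thus nr: "gauss_map x \<notin> \<rat>"
    unfolding gauss_map_def frac_def by (metis Rats_add Rats_of_int diff_add_cancel)
  have "gauss_map x \<noteq> 0" using nr by auto
  thus "gauss_map x \<in> {0<..<1}"
    unfolding gauss_map_def using frac_ge_0[of "1/x"] frac_lt_1[of "1/x"] by auto
qed

text \<open>Indices are shifted by one: for the sequence \<open>a\<^sub>1, a\<^sub>2, \<dots>\<close> the convergents are
  \<open>p\<^sub>t = cf_num a (t + 1)\<close> and \<open>q\<^sub>t = cf_den a (t + 1)\<close>, so that index \<open>0\<close> stands for
  \<open>p\<^sub>-\<^sub>1 = 1\<close> and \<open>q\<^sub>-\<^sub>1 = 0\<close>. The value \<open>a 0\<close> is never used.\<close>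

fun cf_num :: "(nat \<Rightarrow> nat) \<Rightarrow> nat \<Rightarrow> nat" where
  "cf_num a 0 = 1"
| "cf_num a (Suc 0) = 0"
| "cf_num a (Suc (Suc t)) = a (Suc t) * cf_num a (Suc t) + cf_num a t"

fun cf_den :: "(nat \<Rightarrow> nat) \<Rightarrow> nat \<Rightarrow> nat" where
  "cf_den a 0 = 0"
| "cf_den a (Suc 0) = 1"
| "cf_den a (Suc (Suc t)) = a (Suc t) * cf_den a (Suc t) + cf_den a t"

definition partial_sum :: "(nat \<Rightarrow> nat) \<Rightarrow> nat \<Rightarrow> nat" where
  "partial_sum a t = (\<Sum>j=1..t. a j)"

lemma partial_sum_0 [simp]: "partial_sum a 0 = 0"
  and partial_sum_Suc [simp]: "partial_sum a (Suc t) = partial_sum a t + a (Suc t)"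
  by (simp_all add: partial_sum_def)

definition ratio :: "(nat \<Rightarrow> nat) \<Rightarrow> nat \<Rightarrow> real" where
  "ratio a t = real (cf_den a (Suc t)) ^ 2 / 2 ^ partial_sum a t"

lemma quotient_sum_eq: "quotient_sum x = partial_sum (partial_quotient x)"
  by (simp add: fun_eq_iff quotient_sum_def partial_sum_def)

lemma partial_sum_cong:
  "(\<And>j. 1 \<le> j \<Longrightarrow> j \<le> t \<Longrightarrow> a j = b j) \<Longrightarrow> partial_sum a t = partial_sum b t"
  by (simp add: partial_sum_def)

lemma cf_den_cong:
  "(\<And>j. 1 \<le> j \<Longrightarrow> j < t \<Longrightarrow> a j = b j) \<Longrightarrow> cf_den a t = cf_den b t"
  by (induction a t rule: cf_den.induct) auto

lemma cf_det: "real (cf_num a (Suc t)) * real (cf_den a t) - real (cf_num a t) * real (cf_den a (Suc t))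
    = (-1) ^ Suc t"
  by (induction t) (auto simp: algebra_simps)

context
  fixes a :: "nat \<Rightarrow> nat"
  assumes pos: "\<And>j. 1 \<le> j \<Longrightarrow> 1 \<le> a j"
begin

lemma cf_den_pos: "0 < cf_den a (Suc t)"
proof (induction t)
  case (Suc t)
  thus ?case using pos[of "Suc t"] by simp
qed simp

lemma cf_den_mono: "cf_den a t \<le> cf_den a (Suc t)"
proof (cases t)
  case (Suc k)
  have "1 * cf_den a (Suc k) \<le> a (Suc k) * cf_den a (Suc k)"
    using pos[of "Suc k"] by (intro mult_le_mono1) simp
  thus ?thesis unfolding Suc cf_den.simps by linarith
qed simp

lemma cf_den_ge: "t \<le> cf_den a (Suc t)"
proof (induction t)
  case (Suc t)
  have "1 * cf_den a (Suc t) \<le> a (Suc t) * cf_den a (Suc t)"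
    using pos[of "Suc t"] by (intro mult_le_mono1) simp
  moreover have "t = 0 \<or> 0 < cf_den a t" using cf_den_pos[of "t - 1"] by (cases t) auto
  moreover have "0 < a (Suc t) * cf_den a (Suc t)" using cf_den_pos[of t] pos[of "Suc t"] by simp
  ultimately show ?case using Suc unfolding cf_den.simps by linarith
qed simp

lemma cf_num_le_den: "cf_num a (Suc t) \<le> cf_den a (Suc t)"
proof -
  have "cf_num a (Suc t) \<le> cf_den a (Suc t) \<and> cf_num a (Suc (Suc t)) \<le> cf_den a (Suc (Suc t))"
  proof (induction t)
    case 0
    show ?case using pos[of 1] by simp
  next
    case (Suc t)
    have "cf_num a (Suc (Suc (Suc t))) \<le> cf_den a (Suc (Suc (Suc t)))"
      unfolding cf_num.simps(3)[of a "Suc t"] cf_den.simps(3)[of a "Suc t"]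
      using Suc by (intro add_mono mult_le_mono2) blast+
    thus ?case using Suc by blast
  qed
  thus ?thesis by blast
qed

lemma cf_den_le:
  assumes "\<And>j. 1 \<le> j \<Longrightarrow> a j \<le> n"
  shows "cf_den a (Suc (Suc t)) \<le> (n + 1) * cf_den a (Suc t)"
proof -
  have "a (Suc t) * cf_den a (Suc t) \<le> n * cf_den a (Suc t)"
    using assms by (intro mult_le_mono1) simp
  thus ?thesis using cf_den_mono[of t] unfolding cf_den.simps add_mult_distrib by linarith
qed

end

section \<open>Tails of the expansion and approximation of \<open>x\<close> by its
  convergents\<close>

definition convergent_of :: "(nat \<Rightarrow> nat) \<Rightarrow> nat \<Rightarrow> real" where
  "convergent_of a t = real (cf_num a (Suc t)) / real (cf_den a (Suc t))"

locale unit_irrational =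
  fixes x :: real
  assumes unit: "x \<in> {0<..<1}" and irrational: "x \<notin> \<rat>"
begin

abbreviation a :: "nat \<Rightarrow> nat" where "a \<equiv> partial_quotient x"
definition q :: "nat \<Rightarrow> real" where "q t = real (cf_den a (Suc t))"
abbreviation S :: "nat \<Rightarrow> nat" where "S \<equiv> partial_sum a"

text \<open>The tail \<open>[0; a (t+1), a (t+2), ...]\<close>, that is, the reciprocal of the
  complete quotient.\<close>

definition y :: "nat \<Rightarrow> real" where "y t = (gauss_map ^^ t) x"

lemma y_irrational: "y t \<in> {0<..<1} \<and> y t \<notin> \<rat>"
proof (induction t)
  case 0
  show ?case using unit irrational by (simp add: y_def)
next
  case (Suc t)
  thus ?case using gauss_map_irrational[of "y t"] by (simp add: y_def)
qed

lemma y_pos: "0 < y t" and y_less_1: "y t < 1"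
  using y_irrational[of t] by auto

lemma inverse_y: "1 / y t = real (a (Suc t)) + y (Suc t)" and a_ge_1': "1 \<le> a (Suc t)"
proof -
  have "1 < 1 / y t" using y_pos[of t] y_less_1[of t] by (simp add: field_simps)
  hence fl: "1 \<le> \<lfloor>1 / y t\<rfloor>" by linarith
  have A: "a (Suc t) = nat \<lfloor>1 / y t\<rfloor>" by (simp add: partial_quotient_def y_def)
  show "1 \<le> a (Suc t)" using fl A by linarith
  have nn: "real (nat \<lfloor>1 / y t\<rfloor>) = of_int \<lfloor>1 / y t\<rfloor>" using fl by (intro of_nat_nat) linarith
  have "y (Suc t) = frac (1 / y t)" by (simp add: y_def gauss_map_def)
  thus "1 / y t = real (a (Suc t)) + y (Suc t)" unfolding A nn by (simp add: frac_def)
qed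

lemma a_ge_1: "1 \<le> j \<Longrightarrow> 1 \<le> a j"
  using a_ge_1'[of "j - 1"] by simp

lemma q_pos: "0 < q t"
  using cf_den_pos[of a, OF a_ge_1] by (simp add: q_def)

lemma q_mono: "q t \<le> q (Suc t)"
  unfolding q_def using cf_den_mono[of a, OF a_ge_1] of_nat_mono by blast

text \<open>The classical x = (p_t + y_t p_{t-1}) / (q_t + y_t q_{t-1}), free of division. The
  induction step multiplies by \<open>y t\<close>, since
  \<open>y t * (a (Suc t) + y (Suc t)) = 1\<close> turns new terms into old ones.\<close>

lemma x_eq: "x * (q t + y t * real (cf_den a t)) = real (cf_num a (Suc t)) + y t * real (cf_num a t)"
proof (induction t)
  case 0
  show ?case by (simp add: y_def q_def)
next
  case (Suc t)
  have Y: "1 = y t * (real (a (Suc t)) + y (Suc t))"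
    using inverse_y[of t] y_pos[of t] by (simp add: field_simps)
  have "y t * (x * (q (Suc t) + y (Suc t) * q t))
      = x * (q t * (y t * (real (a (Suc t)) + y (Suc t))) + y t * real (cf_den a t))"
    by (simp add: q_def algebra_simps)
  also have "\<dots> = x * (q t + y t * real (cf_den a t))" by (simp only: Y[symmetric] mult_1_right)
  also have "\<dots> = real (cf_num a (Suc t)) * (y t * (real (a (Suc t)) + y (Suc t))) + y t * real (cf_num a t)"
    by (simp only: Suc Y[symmetric] mult_1_right)
  also have "\<dots> = y t * (real (cf_num a (Suc (Suc t))) + y (Suc t) * real (cf_num a (Suc t)))"
    by (simp add: algebra_simps)
  finally show ?case using y_pos[of t] unfolding q_def by (simp del: cf_den.simps cf_num.simps)
qed

text \<open>After inserting \<open>x_eq\<close> at \<open>Suc t\<close> the terms with the tail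
  cancel and the determinant \<open>cf_det\<close> remains. Convergents of even index lie below
  \<open>x\<close>, those of odd index above.\<close>

lemma x_minus_convergent:
  "(-1) ^ t * (x - convergent_of a t) = 1 / (q t * (q (Suc t) + y (Suc t) * q t))"
proof -
  define D where "D = q (Suc t) + y (Suc t) * q t"
  have D: "D > 0" unfolding D_def using q_pos y_pos by (intro add_pos_pos mult_pos_pos) auto
  have "(x - convergent_of a t) * (q t * D) = q t * (x * D) - real (cf_num a (Suc t)) * D"
    using q_pos[of t] by (simp add: convergent_of_def q_def[symmetric] field_simps)
  also have "x * D = real (cf_num a (Suc (Suc t))) + y (Suc t) * real (cf_num a (Suc t))"
    using x_eq[of "Suc t"] by (simp only: D_def q_def)
  also have "q t * \<dots> - real (cf_num a (Suc t)) * D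
      = real (cf_num a (Suc (Suc t))) * q t - real (cf_num a (Suc t)) * q (Suc t)"
    unfolding D_def by algebra
  also have "\<dots> = (-1) ^ t" using cf_det[of a "Suc t"] by (simp add: q_def mult_ac)
  finally have "(-1) ^ t * (x - convergent_of a t) * (q t * D) = (-1) ^ t * (-1) ^ t"
    by (simp only: mult.assoc)
  also have "\<dots> = 1" by (simp flip: power_mult_distrib)
  finally have "(-1) ^ t * (x - convergent_of a t) = 1 / (q t * D)"
    using D q_pos[of t] by (metis mult_pos_pos less_irrefl nonzero_eq_divide_eq)
  thus ?thesis by (simp add: D_def)
qed

lemma convergent_side: "0 < (-1) ^ t * (x - convergent_of a t)"
  unfolding x_minus_convergent using q_pos y_pos
  by (intro divide_pos_pos mult_pos_pos add_pos_pos) auto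

lemma abs_x_minus_convergent: "\<bar>x - convergent_of a t\<bar> = (-1) ^ t * (x - convergent_of a t)"
proof -
  have "\<bar>x - convergent_of a t\<bar> = \<bar>(-1) ^ t * (x - convergent_of a t)\<bar>" by (simp add: abs_mult)
  thus ?thesis using convergent_side[of t] by linarith
qed

lemma abs_x_minus_convergent_le: "\<bar>x - convergent_of a t\<bar> \<le> 1 / (q t * q (Suc t))"
proof -
  have "0 < y (Suc t) * q t" using q_pos y_pos by simp
  hence "q t * q (Suc t) \<le> q t * (q (Suc t) + y (Suc t) * q t)"
    using q_pos[of t] by (intro mult_left_mono) auto
  thus ?thesis
    unfolding abs_x_minus_convergent x_minus_convergent
      using q_pos[of t] q_pos[of "Suc t"] y_pos[of "Suc t"]
    by (intro divide_left_mono) (auto intro!: mult_pos_pos add_pos_pos)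
qed

lemma abs_x_minus_convergent_ge: "1 / (2 * q t * q (Suc t)) \<le> \<bar>x - convergent_of a t\<bar>"
proof -
  have "y (Suc t) * q t \<le> 1 * q t"
    using y_less_1[of "Suc t"] q_pos[of t] by (intro mult_right_mono) auto
  also have "1 * q t \<le> q (Suc t)" using q_mono by simp
  finally have "q t * (q (Suc t) + y (Suc t) * q t) \<le> q t * (2 * q (Suc t))"
    using q_pos[of t] by (intro mult_left_mono) auto
  thus ?thesis
    unfolding abs_x_minus_convergent x_minus_convergent
      using q_pos[of t] q_pos[of "Suc t"] y_pos[of "Suc t"]
    by (intro divide_left_mono) (auto intro!: mult_pos_pos add_pos_pos simp: mult_ac)
qed

lemma convergent_of_unit: "convergent_of a t \<in> {0..1}"
proof -
  have "real (cf_num a (Suc t)) \<le> q t"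
    unfolding q_def using cf_num_le_den[of a t, OF a_ge_1] of_nat_mono by blast
  thus ?thesis using q_pos[of t] by (auto simp: convergent_of_def q_def[symmetric])
qed

lemma convergent_of_tendsto: "convergent_of a \<longlonglongrightarrow> x"
proof -
  have "(\<lambda>t. convergent_of a t - x) \<longlonglongrightarrow> 0"
  proof (rule Lim_null_comparison)
    show "(\<lambda>t. inverse (real t)) \<longlonglongrightarrow> 0" by (rule lim_inverse_n)
    show "\<forall>\<^sub>F t in sequentially. norm (convergent_of a t - x) \<le> inverse (real t)"
    proof (intro eventually_sequentiallyI)
      fix t :: nat assume "1 \<le> t"
      have "\<bar>x - convergent_of a t\<bar> \<le> 1 / (q t * q (Suc t))" by (rule abs_x_minus_convergent_le)
      also have "\<dots> \<le> 1 / (real t * 1)"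
      proof (intro divide_left_mono mult_mono)
        show "real t \<le> q t" unfolding q_def using cf_den_ge[of a t, OF a_ge_1] of_nat_mono by blast
        show "1 \<le> q (Suc t)" using cf_den_pos[of a "Suc t", OF a_ge_1]
          by (simp add: q_def Suc_le_eq del: cf_den.simps of_nat_add of_nat_mult)
      qed (use q_pos[of t] q_pos[of "Suc t"] \<open>1 \<le> t\<close> in auto)
      finally show "norm (convergent_of a t - x) \<le> inverse (real t)"
        by (simp add: abs_minus_commute inverse_eq_divide)
    qed
  qed
  thus ?thesis by (rule LIM_zero_cancel)
qed

end

section \<open>Values of the question mark function at convergents\<close>

text \<open>Unimodular fractions are consecutive in some Farey set. The absolute value admits either
  order, as needed for alternating convergents.\<close>

lemma question_mark_mediant:
  assumes "0 < q" "0 < q'" "p \<le> q" "p' \<le> q'" "\<bar>real p' * real q - real p * real q'\<bar> = 1"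
  shows "question_mark (real (p + p') / real (q + q'))
    = (question_mark (real p / real q) + question_mark (real p' / real q')) / 2"
proof -
  have med: "question_mark (real (p + p') / real (q + q'))
      = (question_mark (real p / real q) + question_mark (real p' / real q')) / 2"
    if "0 < q" "0 < q'" "p \<le> q" "p' \<le> q'" "p' * q = p * q' + 1" for p q p' q'
    using is_question_mark_question_mark det_consecutive_farey[OF that]
    unfolding is_question_mark_def by blast
  have "real (p' * q) = real (p * q' + 1) \<or> real (p * q') = real (p' * q + 1)"
    using assms(5) by (auto simp: abs_if split: if_splits)
  hence "p' * q = p * q' + 1 \<or> p * q' = p' * q + 1" by (simp only: of_nat_eq_iff)
  thus ?thesis
    using med[of q q' p p'] med[of q' q p' p] assms by (auto simp: add.commute)
qed

text \<open>Mediants with the same fraction keep the determinant, and each halves the remaining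
  difference of values. A convergent arises in this way from its two predecessors.\<close>

lemma question_mark_iterated_mediant:
  assumes "0 < q" "0 < q'" "p \<le> q" "p' \<le> q'" "\<bar>real p' * real q - real p * real q'\<bar> = 1"
  shows "question_mark (real (b * p + p') / real (b * q + q'))
    = question_mark (real p / real q) + (question_mark (real p' / real q') - question_mark (real p / real q)) / 2 ^ b"
proof (induction b)
  case (Suc b)
  have "real (b * p + p') * real q - real p * real (b * q + q') = real p' * real q - real p * real q'"
    by (simp add: algebra_simps)
  moreover have "b * p + p' \<le> b * q + q'" using assms by (intro add_mono mult_le_mono2)
  ultimately have "question_mark (real (p + (b * p + p')) / real (q + (b * q + q')))
      = (question_mark (real p / real q) + question_mark (real (b * p + p') / real (b * q + q'))) / 2"
    using assms by (intro question_mark_mediant) auto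
  thus ?case unfolding Suc by (simp add: add.assoc add_divide_distrib diff_divide_distrib)
qed simp

lemma question_mark_strict_mono: "u \<in> {0..1} \<Longrightarrow> v \<in> {0..1} \<Longrightarrow> u < v \<Longrightarrow> question_mark u < question_mark v"
  using is_question_mark_question_mark unfolding is_question_mark_def strict_mono_on_def by blast

lemma question_mark_0_1: "question_mark 0 = 0" "question_mark 1 = 1"
  using is_question_mark_question_mark unfolding is_question_mark_def by auto

text \<open>Starts the recursion: the convergent of index \<open>-1\<close> is \<open>1/0\<close>,
  so the first partial quotient is handled by \<open>b - 1\<close> mediants with \<open>0/1\<close>,
  starting from \<open>1/1\<close>.\<close>

lemma question_mark_unit_fraction:
  assumes "1 \<le> b" shows "question_mark (1 / real b) = 2 / 2 ^ b"
proof -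
  obtain c where b: "b = Suc c" using assms by (cases b) auto
  show ?thesis
    using question_mark_iterated_mediant[of 1 1 0 1 c] by (simp add: b question_mark_0_1 add.commute)
qed

context unit_irrational
begin

text \<open>These are the terms of the alternating series for the question mark function; the
  induction step is one iterated mediant.\<close>

lemma question_mark_convergent_diff:
  "question_mark (convergent_of a (Suc t)) - question_mark (convergent_of a t)
     = (-1) ^ t * 2 / 2 ^ S (Suc t)"
proof (induction t)
  case 0
  show ?case using question_mark_unit_fraction[OF a_ge_1, of 1]
    by (simp add: convergent_of_def question_mark_0_1)
next
  case (Suc t)
  have "question_mark (convergent_of a (Suc (Suc t))) = question_mark (convergent_of a (Suc t))
     + (question_mark (convergent_of a t) - question_mark (convergent_of a (Suc t))) / 2 ^ a (Suc (Suc t))"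
    unfolding convergent_of_def cf_num.simps(3)[of a "Suc t"] cf_den.simps(3)[of a "Suc t"]
  proof (rule question_mark_iterated_mediant)
    have "real (cf_num a (Suc t)) * real (cf_den a (Suc (Suc t)))
        - real (cf_num a (Suc (Suc t))) * real (cf_den a (Suc t)) = - ((-1) ^ Suc (Suc t))"
      using cf_det[of a "Suc t"] by (simp only: algebra_simps)
    thus "\<bar>real (cf_num a (Suc t)) * real (cf_den a (Suc (Suc t)))
        - real (cf_num a (Suc (Suc t))) * real (cf_den a (Suc t))\<bar> = 1"
      by (simp only: abs_minus_cancel abs_power_minus abs_one power_one power_abs)
  qed (rule cf_den_pos cf_num_le_den; rule a_ge_1, simp)+
  also have "question_mark (convergent_of a t) - question_mark (convergent_of a (Suc t))
      = - ((-1) ^ t * 2 / 2 ^ S (Suc t))" using Suc by linarith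
  finally show ?case by (simp add: power_add)
qed

lemma question_mark_side: "0 < (-1) ^ t * (question_mark x - question_mark (convergent_of a t))"
  using convergent_side[of t] question_mark_strict_mono[of x "convergent_of a t"]
    question_mark_strict_mono[of "convergent_of a t" x] unit convergent_of_unit[of t]
  by (cases "even t") auto

lemma abs_question_mark_diff:
  "\<bar>question_mark (convergent_of a t) - question_mark x\<bar>
     = (-1) ^ t * (question_mark x - question_mark (convergent_of a t))"
proof -
  have "\<bar>question_mark (convergent_of a t) - question_mark x\<bar>
      = \<bar>(-1) ^ t * (question_mark x - question_mark (convergent_of a t))\<bar>"
    by (simp add: abs_mult abs_minus_commute)
  thus ?thesis using question_mark_side[of t] by linarith
qed

lemma abs_question_mark_diff_le:
  "\<bar>question_mark (convergent_of a t) - question_mark x\<bar> \<le> 2 / 2 ^ S (Suc t)"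
proof -
  have "(-1) ^ t * (question_mark (convergent_of a (Suc t)) - question_mark (convergent_of a t))
      = ((-1) ^ t * (-1) ^ t) * (2 / 2 ^ S (Suc t))"
    unfolding question_mark_convergent_diff by simp
  also have "(-1::real) ^ t * (-1) ^ t = 1" by (simp flip: power_mult_distrib)
  finally show ?thesis
    unfolding abs_question_mark_diff
      using question_mark_side[of "Suc t"] by (simp add: algebra_simps)
qed

text \<open>The convergent of index \<open>t + 2\<close> lies between that of index \<open>t\<close>
  and \<open>x\<close>, and the second of the two series terms in between is at most half of the
  first.\<close>

lemma abs_question_mark_diff_ge:
  "1 / 2 ^ S (Suc t) \<le> \<bar>question_mark (convergent_of a t) - question_mark x\<bar>"
proof -
  have "question_mark (convergent_of a (Suc (Suc t))) - question_mark (convergent_of a t)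
      = (-1) ^ t * (2 / 2 ^ S (Suc t) - 2 / 2 ^ S (Suc (Suc t)))"
    using question_mark_convergent_diff[of t] question_mark_convergent_diff[of "Suc t"]
    by (simp add: algebra_simps)
  hence "(-1) ^ t * (question_mark (convergent_of a (Suc (Suc t))) - question_mark (convergent_of a t))
      = ((-1) ^ t * (-1) ^ t) * (2 / 2 ^ S (Suc t) - 2 / 2 ^ S (Suc (Suc t)))"
    by (simp only: mult.assoc)
  also have "(-1::real) ^ t * (-1) ^ t = 1" by (simp flip: power_mult_distrib)
  finally have "2 / 2 ^ S (Suc t) - 2 / 2 ^ S (Suc (Suc t))
      \<le> \<bar>question_mark (convergent_of a t) - question_mark x\<bar>"
    unfolding abs_question_mark_diff
      using question_mark_side[of "Suc (Suc t)"] by (simp add: algebra_simps)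
  moreover have "2 / 2 ^ S (Suc (Suc t)) \<le> (1 / 2 ^ S (Suc t) :: real)"
  proof -
    have "(2::real) * 2 ^ S (Suc t) \<le> 2 ^ S (Suc (Suc t))"
      using power_increasing[of "Suc (S (Suc t))" "S (Suc (Suc t))" "2::real"] a_ge_1[of "Suc (Suc t)"] by simp
    thus ?thesis by (simp add: divide_simps)
  qed
  ultimately show ?thesis by simp
qed

end

section \<open>An extremal problem for continuants\<close>

definition golden :: real where "golden = (1 + sqrt 5) / 2"

lemma golden_sq: "golden ^ 2 = golden + 1"
  by (simp add: golden_def power2_eq_square field_simps)

lemma golden_bounds: "(809 / 500) < golden" "golden < (16181 / 10000)"
proof -
  have "(559 / 250) < sqrt 5" by (rule real_less_rsqrt) (simp add: power2_eq_square)
  moreover have "sqrt 5 < (11181 / 5000)" by (rule real_less_lsqrt) (simp_all add: power2_eq_square)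
  ultimately show "(809 / 500) < golden" "golden < (16181 / 10000)" by (simp_all add: golden_def)
qed

lemma golden_inverse: "1 / golden + 1 / golden ^ 2 = 1"
  using golden_sq golden_bounds by (simp add: field_simps power2_eq_square)

text \<open>The larger eigenvalue of the product of the matrices of the steps \<open>1\<close> and
  \<open>n\<close>, which has trace \<open>n + 2\<close> and determinant \<open>1\<close>.\<close>

definition pair_root :: "nat \<Rightarrow> real" where
  "pair_root n = (real n + 2 + sqrt (real n ^ 2 + 4 * real n)) / 2"

definition tilt :: "nat \<Rightarrow> real" where
  "tilt n = ((real n - 1) * ln (sqrt 2) - ln (pair_root n) + 2 * ln golden) / (real n - 1)"

text \<open>Over a sequence the weights multiply to \<open>2 ^ (S / 2)\<close> times a factor
  depending only on \<open>S - kappa n * t\<close>. The constants are tuned so that \<open>1\<close>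
  has weight \<open>golden\<close> and the pair \<open>1, n\<close> has weight
  \<open>pair_root n\<close>.\<close>

definition weight :: "nat \<Rightarrow> nat \<Rightarrow> real" where
  "weight n k = exp (real k * ln (sqrt 2) - tilt n * (real k - kappa n))"

definition skew :: "nat \<Rightarrow> real" where
  "skew n = 1 - 1 / pair_root n"

text \<open>Serves the values \<open>n = k + 15\<close>, where \<open>golden ^ 2 < 2.6181\<close> is
  far enough below \<open>3\<close> for the crude bound \<open>n + 2\<close> on
  \<open>pair_root n\<close>.\<close>

lemma golden_sq_power_bound:
  "4 * ((26181 / 10000)::real) ^ (k + 13) * (real k + 17) < 4 * 3 ^ (k + 14)"
proof (induction k)
  case 0
  show ?case by (simp add: power_numeral_even power_numeral_odd)
next
  case (Suc k)
  have "4 * ((26181 / 10000)::real) ^ (Suc k + 13) * (real (Suc k) + 17)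
      = 4 * (26181 / 10000) ^ (k + 13) * ((26181 / 10000) * (real k + 18))"
    by (simp only: add_Suc power_Suc of_nat_Suc) algebra
  also have "\<dots> \<le> 4 * (26181 / 10000) ^ (k + 13) * (3 * (real k + 17))"
    by (intro mult_left_mono) auto
  also have "\<dots> = 3 * (4 * (26181 / 10000) ^ (k + 13) * (real k + 17))" by simp
  also have "\<dots> < 3 * (4 * 3 ^ (k + 14))" using Suc by simp
  also have "\<dots> = 4 * 3 ^ (Suc k + 14)" by (simp only: add_Suc power_Suc)
  finally show ?case .
qed

context
  fixes n :: nat
  assumes n: "5 \<le> n"
begin

private abbreviation (input) "\<mu> \<equiv> pair_root n"
private abbreviation (input) "\<sigma> \<equiv> skew n"
private abbreviation (input) "\<kappa> \<equiv> kappa n"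
private abbreviation (input) "\<beta> \<equiv> tilt n"

lemma pair_root_eq: "\<mu> * \<mu> = (real n + 2) * \<mu> - 1"
proof -
  have "sqrt (real n ^ 2 + 4 * real n) ^ 2 = real n ^ 2 + 4 * real n" by simp
  thus ?thesis unfolding pair_root_def by (simp add: field_simps power2_eq_square)
qed

lemma pair_root_ge: "real n + (17 / 10) \<le> \<mu>"
proof -
  have "real n + (7 / 5) \<le> sqrt (real n ^ 2 + 4 * real n)"
    using n by (intro real_le_rsqrt) (simp add: power2_eq_square algebra_simps)
  thus ?thesis by (simp add: pair_root_def)
qed

lemma pair_root_inverse: "\<mu> = real n + 2 - 1 / \<mu>"
proof -
  have "\<mu> > 0" using pair_root_ge n by linarith
  thus ?thesis using pair_root_eq by (simp add: field_simps)
qed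

lemma pair_root_le: "\<mu> \<le> real n + 2 - 1 / (real n + 2)"
proof -
  have p: "\<mu> > 0" using pair_root_ge n by linarith
  hence "\<mu> \<le> real n + 2" using pair_root_inverse by (smt (verit) divide_pos_pos)
  hence "1 / (real n + 2) \<le> 1 / \<mu>" using p by (intro divide_left_mono) auto
  thus ?thesis using pair_root_inverse by linarith
qed

lemma skew_bounds: "(17 / 20) \<le> \<sigma>" "\<sigma> < 1"
proof -
  have "(67 / 10) \<le> \<mu>" using pair_root_ge n by linarith
  thus "(17 / 20) \<le> \<sigma>" "\<sigma> < 1" by (simp_all add: skew_def field_simps)
qed

text \<open>The row \<open>(1, skew n)\<close> times the matrix of the step \<open>n\<close> is
  \<open>(n + skew n, 1)\<close>; these equations make it \<open>pair_root n\<close> times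
  \<open>(skew n, 1 - skew n)\<close>.\<close>

lemma skew_pair_root: "\<mu> * \<sigma> = real n + \<sigma>" "\<mu> * (1 - \<sigma>) = 1"
proof -
  have "\<mu> > 0" using pair_root_ge n by linarith
  thus "\<mu> * (1 - \<sigma>) = 1" by (simp add: skew_def)
  have "\<mu> * \<sigma> = \<mu> - 1" using \<open>\<mu> > 0\<close> by (simp add: skew_def field_simps)
  thus "\<mu> * \<sigma> = real n + \<sigma>" using pair_root_inverse by (simp add: skew_def)
qed

text \<open>Over ones the denominators outgrow \<open>2 ^ (S / 2)\<close>, over pairs
  \<open>1, n\<close> they fall behind. The second inequality would fail for
  \<open>n = 4\<close>.\<close>

lemma ln_sqrt2_bounds: "ln (sqrt 2) < ln golden" "ln \<mu> < (real n + 1) * ln (sqrt 2)"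
proof -
  have "sqrt 2 < (3 / 2)" by (rule real_less_lsqrt) (simp_all add: power2_eq_square)
  thus "ln (sqrt 2) < ln golden" using golden_bounds by simp
  \<comment> \<open>With \<open>k = n - 5\<close> this is \<open>(n + 2) ^ 2 < 2 ^ (n + 1)\<close>,
    starting at \<open>49 < 64\<close>.\<close>
  have "real (k + 7) ^ 2 < 2 ^ (k + 6)" for k
  proof (induction k)
    case (Suc k)
    have "real (Suc k + 7) ^ 2 \<le> 2 * real (k + 7) ^ 2" by (simp add: power2_eq_square algebra_simps)
    also have "\<dots> < 2 * 2 ^ (k + 6)" using Suc by simp
    finally show ?case by (simp only: add_Suc power_Suc)
  qed simp
  from this[of "n - 5"] n have "(real n + 2) ^ 2 < 2 ^ (n + 1)" by (simp add: add.commute)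
  moreover have "\<mu> ^ 2 \<le> (real n + 2) ^ 2"
  proof (rule power_mono)
    have "0 \<le> 1 / (real n + 2)" by simp
    thus "\<mu> \<le> real n + 2" using pair_root_le by linarith
    show "0 \<le> \<mu>" using pair_root_ge n by linarith
  qed
  ultimately have "\<mu> ^ 2 < 2 ^ (n + 1)" by linarith
  moreover have "0 < \<mu>" using pair_root_ge n by linarith
  ultimately have "ln (\<mu> ^ 2) < ln (2 ^ (n + 1))" by simp
  hence "2 * ln \<mu> < (real n + 1) * ln 2"
    using \<open>0 < \<mu>\<close> by (simp add: ln_realpow add.commute del: power_Suc)
  thus "ln \<mu> < (real n + 1) * ln (sqrt 2)" by (simp add: ln_sqrt)
qed

lemma tilt_pos: "0 < \<beta>"
proof -
  have "0 < (real n - 1) * ln (sqrt 2) - ln \<mu> + 2 * ln golden"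
    using ln_sqrt2_bounds by (simp add: algebra_simps)
  thus ?thesis unfolding tilt_def using n by simp
qed

text \<open>The denominator of \<open>kappa n\<close> is \<open>tilt n * (n - 1)\<close>. Both
  equations are the neutrality conditions behind \<open>weight_1\<close> and
  \<open>weight_n\<close>.\<close>

lemma kappa_eq: "\<beta> * (\<kappa> - 1) = ln golden - ln (sqrt 2)"
  and kappa_eq': "\<beta> * (real n + 1 - 2 * \<kappa>) = (real n + 1) * ln (sqrt 2) - ln \<mu>"
proof -
  define D where "D = (real n - 1) * ln (sqrt 2) - ln \<mu> + 2 * ln golden"
  have D: "D = \<beta> * (real n - 1)" using n by (simp add: tilt_def D_def)
  hence D0: "D \<noteq> 0" using tilt_pos n by simp
  have "\<kappa> = ((real n + 1) * ln golden - ln \<mu>) / D"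
    unfolding kappa_def D_def pair_root_def golden_def by (simp add: algebra_simps)
  hence "\<kappa> * D = (real n + 1) * ln golden - ln \<mu>" using D0 by simp
  hence "(\<kappa> - 1) * D = (real n - 1) * (ln golden - ln (sqrt 2))"
    unfolding D_def by (simp add: algebra_simps)
  hence "(real n - 1) * (\<beta> * (\<kappa> - 1)) = (real n - 1) * (ln golden - ln (sqrt 2))"
    unfolding D by (simp add: algebra_simps)
  thus 1: "\<beta> * (\<kappa> - 1) = ln golden - ln (sqrt 2)" using n by simp
  have "\<beta> * (real n + 1 - 2 * \<kappa>) = D - 2 * (\<beta> * (\<kappa> - 1))" unfolding D by (simp add: algebra_simps)
  thus "\<beta> * (real n + 1 - 2 * \<kappa>) = (real n + 1) * ln (sqrt 2) - ln \<mu>"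
    unfolding 1 D_def by (simp add: algebra_simps)
qed

lemma kappa_bounds: "1 < \<kappa>" "2 * \<kappa> < real n + 1"
proof -
  have "0 < \<beta> * (\<kappa> - 1)" unfolding kappa_eq using ln_sqrt2_bounds by simp
  thus "1 < \<kappa>" using tilt_pos by (simp add: zero_less_mult_iff)
  have "0 < \<beta> * (real n + 1 - 2 * \<kappa>)" unfolding kappa_eq' using ln_sqrt2_bounds by simp
  thus "2 * \<kappa> < real n + 1" using tilt_pos by (simp add: zero_less_mult_iff)
qed

section \<open>Comparison of the weights of the entries\<close>

lemma weight_pos: "0 < weight n k" by (simp add: weight_def)

lemma weight_1: "weight n 1 = golden"
proof -
  have "weight n 1 = exp (ln (sqrt 2) + \<beta> * (\<kappa> - 1))" by (simp add: weight_def algebra_simps)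
  thus ?thesis unfolding kappa_eq using golden_bounds by simp
qed

lemma weight_n: "weight n n = \<mu> / golden"
proof -
  have "weight n n = exp ((real n + 1) * ln (sqrt 2) - ln (sqrt 2) - \<beta> * (real n + 1 - 2 * \<kappa>) - \<beta> * (\<kappa> - 1))"
    by (simp add: weight_def algebra_simps)
  also have "\<dots> = exp (ln \<mu> - ln golden)" unfolding kappa_eq kappa_eq' by simp
  finally show ?thesis using golden_bounds pair_root_ge n by (simp add: exp_diff)
qed

lemma ln_weight: "ln (weight n k) = (real k - 1) * ((ln \<mu> - 2 * ln golden) / (real n - 1)) + ln golden"
proof -
  have L: "(ln \<mu> - 2 * ln golden) / (real n - 1) = ln (sqrt 2) - \<beta>"
    using n by (simp add: tilt_def field_simps)
  have G: "ln golden = ln (sqrt 2) + \<beta> * (\<kappa> - 1)" unfolding kappa_eq by simp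
  show ?thesis by (subst L, subst G) (simp add: weight_def algebra_simps)
qed

lemma golden_sq_less_pair_root: "golden ^ 2 < \<mu>"
  using golden_sq golden_bounds pair_root_ge n by simp

lemma weight_strict_mono: "j < k \<Longrightarrow> weight n j < weight n k"
proof -
  assume "j < k"
  have "ln (golden ^ 2) < ln \<mu>"
    using golden_sq_less_pair_root golden_bounds pair_root_ge by (subst ln_less_cancel_iff) auto
  hence "0 < ln \<mu> - 2 * ln golden" using golden_bounds by (simp add: ln_realpow)
  hence "ln (weight n j) < ln (weight n k)"
    unfolding ln_weight using \<open>j < k\<close> n by (simp add: divide_strict_right_mono)
  thus ?thesis using weight_pos by simp
qed

text \<open>The inequality \<open>weight_2_less\<close> with the logarithms removed.\<close>

lemma golden_power_pair_root_less: "golden ^ (2 * (n - 2)) * \<mu> < (3 + 2 / (\<mu> - 1)) ^ (n - 1)"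
proof -
  define c where "c = ((26181 / 10000)::real)"
  have mu: "\<mu> > 6" using pair_root_ge n by linarith
  have g: "golden ^ (2 * (n - 2)) \<le> c ^ (n - 2)"
    unfolding power_mult c_def using golden_sq golden_bounds by (intro power_mono) auto
  \<comment> \<open>A rational upper bound for \<open>pair_root n\<close>; it enlarges the left side
    and shrinks the right one, so every single \<open>n\<close> becomes an exact
    computation.\<close>
  define m where "m = real n + 2 - 1 / (real n + 2)"
  have m: "\<mu> \<le> m" unfolding m_def by (rule pair_root_le)
  have m1: "m > 1" using m mu by linarith
  have "golden ^ (2 * (n - 2)) * \<mu> \<le> c ^ (n - 2) * m"
    using g m mu by (intro mult_mono) (auto simp: c_def)
  also have "\<dots> < (3 + 2 / (m - 1)) ^ (n - 1)"
  proof (cases "n \<le> 14")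
    case True
    with n have "n = 5 \<or> n = 6 \<or> n = 7 \<or> n = 8 \<or> n = 9 \<or> n = 10 \<or> n = 11 \<or> n = 12 \<or> n = 13 \<or> n = 14"
      by arith
    thus ?thesis unfolding c_def m_def
      by (elim disjE) (simp_all add: power_numeral_even power_numeral_odd)
  next
    case False
    define k where "k = n - 15"
    have k: "n = k + 15" using False by (simp add: k_def)
    have "c ^ (n - 2) * m \<le> c ^ (n - 2) * (real n + 2)"
      by (intro mult_left_mono) (auto simp: m_def c_def)
    also have "\<dots> < 3 ^ (n - 1)" using golden_sq_power_bound[of k] by (simp add: k c_def add.commute)
    also have "\<dots> \<le> (3 + 2 / (m - 1)) ^ (n - 1)" using m1 by (intro power_mono) auto
    finally show ?thesis .
  qed
  also have "\<dots> \<le> (3 + 2 / (\<mu> - 1)) ^ (n - 1)"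
    using m mu by (intro power_mono add_left_mono divide_left_mono) (auto simp: divide_simps)
  finally show ?thesis .
qed

text \<open>As \<open>(2 + skew n) / skew n = 3 + 2 / (pair_root n - 1)\<close> and
  \<open>ln (weight n k)\<close> is affine in \<open>k\<close>, this follows from
  \<open>golden_power_pair_root_less\<close> on taking logarithms.\<close>

lemma weight_2_less:
  "(real n + \<sigma>) * weight n 2 < (2 + \<sigma>) * weight n n"
proof -
  define y where "y = (3 + 2 / (\<mu> - 1)) / golden ^ 2"
  have mu: "\<mu> > 6" using pair_root_ge n by linarith
  have g: "golden > 0" using golden_bounds by simp
  have y: "y > 0" unfolding y_def using mu g by (intro divide_pos_pos add_pos_pos) auto
  have "golden ^ (2 * (n - 1)) = golden ^ 2 * golden ^ (2 * (n - 2))"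
  proof -
    have "2 * (n - 1) = 2 + 2 * (n - 2)" using n by simp
    thus ?thesis by (simp only: power_add)
  qed
  hence "\<mu> / golden ^ 2 = golden ^ (2 * (n - 2)) * \<mu> / golden ^ (2 * (n - 1))"
    using g by simp
  also have "\<dots> < (3 + 2 / (\<mu> - 1)) ^ (n - 1) / golden ^ (2 * (n - 1))"
    using golden_power_pair_root_less g by (intro divide_strict_right_mono) auto
  also have "\<dots> = y ^ (n - 1)" by (simp add: y_def power_divide power_mult)
  finally have "ln (\<mu> / golden ^ 2) < ln (y ^ (n - 1))"
    using mu g y by (subst ln_less_cancel_iff) auto
  hence "ln \<mu> - 2 * ln golden < real (n - 1) * ln y"
    using mu g y by (simp add: ln_div ln_realpow)
  hence "(ln \<mu> - 2 * ln golden) / (real n - 1) < ln y"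
    using n by (simp add: divide_simps of_nat_diff mult.commute)
  hence "ln (weight n 2) < ln (y * golden)" unfolding ln_weight using g y by (simp add: ln_mult)
  hence "weight n 2 < y * golden" using weight_pos g y by (subst (asm) ln_less_cancel_iff) auto
  moreover have "\<sigma> = (\<mu> - 1) / \<mu>" using mu by (simp add: skew_def field_simps)
  hence "3 + 2 / (\<mu> - 1) = (2 + \<sigma>) / \<sigma>"
    using mu skew_bounds by (simp add: divide_simps) (simp add: algebra_simps)
  hence "y * golden = (2 + \<sigma>) / (\<sigma> * golden)" using g by (simp add: y_def power2_eq_square)
  ultimately have "weight n 2 < (2 + \<sigma>) / (\<sigma> * golden)" by simp
  hence "\<mu> * \<sigma> * weight n 2 < \<mu> * \<sigma> * ((2 + \<sigma>) / (\<sigma> * golden))"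
    using skew_bounds mu by (intro mult_strict_left_mono) auto
  also have "\<dots> = (2 + \<sigma>) * (\<mu> / golden)" using skew_bounds by simp
  finally show ?thesis unfolding skew_pair_root weight_n .
qed

text \<open>The function \<open>k \<mapsto> ln (k + \<sigma>) - ln (weight n k)\<close> is concave, so on \<open>{2..n}\<close> it is
  enough to compare the two ends.\<close>

lemma intermediate_quotient_gain:
  assumes "2 \<le> k" "k < n"
  shows "(real n + \<sigma>) * weight n k < (real k + \<sigma>) * weight n n"
proof -
  define u where "u = (real n - real k) / (real n - 2)"
  have u: "0 < u" "u \<le> 1" using assms by (auto simp: u_def)
  have nk: "real k = u * 2 + (1 - u) * real n"
  proof -
    have "u * (real n - 2) = real n - real k" using n by (simp add: u_def)
    thus ?thesis by (simp add: algebra_simps)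
  qed
  define c where "c = (ln \<mu> - 2 * ln golden) / (real n - 1)"
  have w: "ln (weight n j) = (real j - 1) * c + ln golden" for j unfolding c_def by (rule ln_weight)
  have "u * ln (2 + \<sigma>) + (1 - u) * ln (real n + \<sigma>) \<le> ln (u * (2 + \<sigma>) + (1 - u) * (real n + \<sigma>))"
    using concave_onD[OF ln_concave, of "1 - u" "2 + \<sigma>" "real n + \<sigma>"] u skew_bounds n by simp
  also have "u * (2 + \<sigma>) + (1 - u) * (real n + \<sigma>) = real k + \<sigma>"
    unfolding nk by (simp add: algebra_simps)
  finally have 1: "u * ln (2 + \<sigma>) + (1 - u) * ln (real n + \<sigma>) \<le> ln (real k + \<sigma>)" .
  have "ln ((real n + \<sigma>) * weight n 2) < ln ((2 + \<sigma>) * weight n n)"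
    using weight_2_less skew_bounds weight_pos[of 2] weight_pos[of n] n by (subst ln_less_cancel_iff) auto
  hence "ln (real n + \<sigma>) + ln (weight n 2) < ln (2 + \<sigma>) + ln (weight n n)"
    using skew_bounds weight_pos[of 2] weight_pos[of n] n by (simp add: ln_mult)
  hence "u * (ln (real n + \<sigma>) + c) < u * (ln (2 + \<sigma>) + (real n - 1) * c)"
    unfolding w using u by (intro mult_strict_left_mono) auto
  hence "ln (real n + \<sigma>) + (real k - 1) * c < ln (real k + \<sigma>) + (real n - 1) * c"
    using 1 unfolding nk by (simp add: algebra_simps)
  hence "ln ((real n + \<sigma>) * weight n k) < ln ((real k + \<sigma>) * weight n n)"
    using skew_bounds weight_pos[of k] weight_pos[of n] n assms by (simp add: ln_mult w)
  thus ?thesis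
    using skew_bounds weight_pos[of k] weight_pos[of n] n by (subst (asm) ln_less_cancel_iff) auto
qed

text \<open>Finitely many strict inequalities leave a common factor. The cap \<open>51 / 50\<close>
  lets it serve the gains at \<open>n, n\<close> and \<open>n, 1, 1\<close> as well.\<close>

lemma ex_uniform_gain:
  obtains g where "1 < g" "g \<le> (51 / 50)"
    "\<And>k. 2 \<le> k \<Longrightarrow> k < n \<Longrightarrow> g * (real n + \<sigma>) * weight n k \<le> (real k + \<sigma>) * weight n n"
    "\<And>k. 2 \<le> k \<Longrightarrow> k < n \<Longrightarrow> g * weight n k \<le> weight n n"
proof -
  define A where "A = insert (51 / 50) ((\<lambda>k. (real k + \<sigma>) * weight n n / ((real n + \<sigma>) * weight n k)) ` {2..<n}
    \<union> (\<lambda>k. weight n n / weight n k) ` {2..<n})"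
  have A: "finite A" "A \<noteq> {}" by (auto simp: A_def)
  have "1 < v" if "v \<in> A" for v
    using that intermediate_quotient_gain weight_strict_mono[of _ n] weight_pos skew_bounds n
    by (auto simp: A_def divide_simps mult_pos_pos)
  hence 1: "1 < Min A" using A by simp
  have le: "Min A \<le> v" if "v \<in> A" for v using A that by simp
  show ?thesis
  proof
    show "1 < Min A" by (rule 1)
    show "Min A \<le> (51 / 50)" by (rule le) (simp add: A_def)
    fix k assume k: "2 \<le> k" "k < n"
    have "Min A \<le> (real k + \<sigma>) * weight n n / ((real n + \<sigma>) * weight n k)"
      using k by (intro le) (auto simp: A_def)
    moreover have "0 < (real n + \<sigma>) * weight n k" using weight_pos[of k] skew_bounds by simp
    ultimately show "Min A * (real n + \<sigma>) * weight n k \<le> (real k + \<sigma>) * weight n n"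
      by (simp add: pos_le_divide_eq mult.assoc)
    have "Min A \<le> weight n n / weight n k" using k by (intro le) (auto simp: A_def)
    thus "Min A * weight n k \<le> weight n n" using weight_pos[of k] by (simp add: field_simps)
  qed
qed

section \<open>Two normalised linear functionals of consecutive denominators\<close>

definition cum_weight :: "(nat \<Rightarrow> nat) \<Rightarrow> nat \<Rightarrow> real" where
  "cum_weight a t = (\<Prod>j=1..t. weight n (a j))"

lemma cum_weight_Suc: "cum_weight a (Suc t) = weight n (a (Suc t)) * cum_weight a t"
  by (simp add: cum_weight_def)

lemma cum_weight_pos: "0 < cum_weight a t"
  unfolding cum_weight_def by (intro prod_pos) (simp add: weight_pos)

lemma cum_weight_eq:
  "cum_weight a t = exp (real (partial_sum a t) * ln (sqrt 2) - \<beta> * (real (partial_sum a t) - \<kappa> * real t))"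
proof (induction t)
  case 0
  show ?case by (simp add: cum_weight_def)
next
  case (Suc t)
  show ?case unfolding cum_weight_Suc Suc weight_def
    by (simp add: algebra_simps flip: exp_add)
qed

text \<open>The row vectors \<open>A = (1, \<sigma>)\<close> and \<open>B = golden * (\<sigma>, 1 - \<sigma>)\<close> are left eigenvectors of the two
  products of the matrices of the steps \<open>1\<close> and \<open>n\<close>: after division by the weights, the step \<open>n\<close>
  carries \<open>A\<close> to \<open>B\<close> and the step \<open>1\<close> carries \<open>B\<close> to \<open>A\<close>. Their values on \<open>(q\<^sub>t, q\<^sub>t\<^sub>-\<^sub>1)\<close> are
  divided by the product of the weights of the steps made so far.\<close>

definition lev1 :: "(nat \<Rightarrow> nat) \<Rightarrow> nat \<Rightarrow> real" where
  "lev1 a t = (real (cf_den a (Suc t)) + \<sigma> * real (cf_den a t)) / cum_weight a t"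

definition lev2 :: "(nat \<Rightarrow> nat) \<Rightarrow> nat \<Rightarrow> real" where
  "lev2 a t = golden * (\<sigma> * real (cf_den a (Suc t)) + (1 - \<sigma>) * real (cf_den a t)) / cum_weight a t"

lemma lev_Suc:
  "lev1 a (Suc t) = ((real (a (Suc t)) + \<sigma>) * real (cf_den a (Suc t)) + real (cf_den a t))
     / (weight n (a (Suc t)) * cum_weight a t)"
  "lev2 a (Suc t) = golden * ((\<sigma> * real (a (Suc t)) + 1 - \<sigma>) * real (cf_den a (Suc t)) + \<sigma> * real (cf_den a t))
     / (weight n (a (Suc t)) * cum_weight a t)"
  by (simp_all add: lev1_def lev2_def cum_weight_Suc algebra_simps)

text \<open>By \<open>skew_pair_root\<close>, \<open>lev2\<close> is the value that
  \<open>lev1\<close> would take after a step \<open>n\<close>; this permits comparing any entry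
  with \<open>n\<close>.\<close>

lemma lev2_eq:
  "lev2 a t = ((real n + \<sigma>) * real (cf_den a (Suc t)) + real (cf_den a t)) / (weight n n * cum_weight a t)"
proof -
  have g: "golden > 0" using golden_bounds by simp
  have mu: "\<mu> > 0" using pair_root_ge n by linarith
  have "(real n + \<sigma>) * u + v = \<mu> * (\<sigma> * u + (1 - \<sigma>) * v)" for u v
  proof -
    have "\<mu> * (\<sigma> * u + (1 - \<sigma>) * v) = (\<mu> * \<sigma>) * u + (\<mu> * (1 - \<sigma>)) * v" by (simp add: algebra_simps)
    thus ?thesis unfolding skew_pair_root by simp
  qed
  thus ?thesis using g mu by (simp add: lev2_def weight_n)
qed

text \<open>The step \<open>1\<close> carries the row \<open>(1, skew n)\<close> to
  \<open>(1, skew n) + (skew n, 1 - skew n)\<close>. By \<open>golden_inverse\<close> the new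
  \<open>lev1\<close> is a convex combination of the old values.\<close>

lemma lev_step_1:
  assumes "a (Suc t) = 1"
  shows "lev1 a (Suc t) = lev1 a t / golden + lev2 a t / golden ^ 2" "lev2 a (Suc t) = lev1 a t"
proof -
  have g: "golden > 0" using golden_bounds by simp
  note c = cum_weight_pos[of a t]
  show "lev2 a (Suc t) = lev1 a t"
    unfolding lev_Suc using g c by (simp add: assms weight_1[simplified] lev1_def)
  have "lev1 a t / golden + lev2 a t / golden ^ 2
      = (real (cf_den a (Suc t)) + \<sigma> * real (cf_den a t) + (\<sigma> * real (cf_den a (Suc t)) + (1 - \<sigma>) * real (cf_den a t)))
        / (golden * cum_weight a t)"
    using g c by (simp add: lev1_def lev2_def power2_eq_square add_divide_distrib mult.commute)
  also have "\<dots> = lev1 a (Suc t)"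
    unfolding lev_Suc using g c by (simp add: assms weight_1[simplified] algebra_simps)
  finally show "lev1 a (Suc t) = lev1 a t / golden + lev2 a t / golden ^ 2" by simp
qed

lemma lev1_step_n:
  assumes "a (Suc t) = n"
  shows "lev1 a (Suc t) = lev2 a t"
  unfolding lev_Suc lev2_eq assms by simp

lemma lev2_step_n:
  assumes "a (Suc t) = n"
  shows "(11 / 10) * lev2 a t \<le> lev2 a (Suc t)"
proof -
  have g: "(11 / 8) \<le> golden * \<sigma>"
    using mult_mono[of "809 / 500" golden "17 / 20" \<sigma>] golden_bounds skew_bounds by simp
  have 1: "(11 / 10) * (real n + \<sigma>) \<le> golden * (\<sigma> * real n + 1 - \<sigma>)"
  proof -
    have "(11 / 10) * (real n + \<sigma>) \<le> 11 / 8 + (11 / 10) * real n" using skew_bounds by simp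
    also have "11 / 8 \<le> (golden * \<sigma> - 11 / 10) * real n"
      using mult_mono[of "11 / 8 - 11 / 10" "golden * \<sigma> - 11 / 10" 5 "real n"] g n by simp
    also have "\<dots> + (11 / 10) * real n \<le> golden * (\<sigma> * real n + 1 - \<sigma>)"
      using golden_bounds skew_bounds by (simp add: algebra_simps)
    finally show ?thesis by simp
  qed
  have "(11 / 10) * ((real n + \<sigma>) * real (cf_den a (Suc t)) + real (cf_den a t))
      = ((11 / 10) * (real n + \<sigma>)) * real (cf_den a (Suc t)) + (11 / 10) * real (cf_den a t)"
        by (simp only: algebra_simps)
  also have "\<dots> \<le> (golden * (\<sigma> * real n + 1 - \<sigma>)) * real (cf_den a (Suc t)) + (golden * \<sigma>) * real (cf_den a t)"
    using 1 g by (intro add_mono mult_right_mono) auto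
  also have "\<dots> = golden * ((\<sigma> * real n + 1 - \<sigma>) * real (cf_den a (Suc t)) + \<sigma> * real (cf_den a t))"
    by (simp only: algebra_simps)
  finally show ?thesis
    unfolding lev2_eq[of a t] lev_Suc assms
    using weight_pos[of n] cum_weight_pos[of a t] by (simp add: divide_simps)
qed

text \<open>After an entry above \<open>1\<close> only \<open>lev1\<close> has to be bounded below.
  Coefficients are compared; since \<open>golden * skew n > 1\<close>, the entry \<open>2\<close> is
  the worst case.\<close>

lemma lev1_le_lev2_step:
  assumes "2 \<le> a (Suc t)"
  shows "lev1 a (Suc t) \<le> lev2 a (Suc t)"
proof -
  have g: "(11 / 8) \<le> golden * \<sigma>"
    using mult_mono[of "809 / 500" golden "17 / 20" \<sigma>] golden_bounds skew_bounds by simp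
  have 1: "real (a (Suc t)) + \<sigma> \<le> golden * (\<sigma> * real (a (Suc t)) + 1 - \<sigma>)"
  proof -
    have "\<sigma> \<le> (8 / 5) * (1 + \<sigma>) - 2" using skew_bounds by (simp add: field_simps)
    also have "\<dots> \<le> golden * (1 + \<sigma>) - 2"
      using golden_bounds skew_bounds by (intro diff_right_mono mult_right_mono) auto
    also have "\<dots> = (golden * \<sigma> - 1) * 2 + golden * (1 - \<sigma>)" by (simp add: algebra_simps)
    also have "(golden * \<sigma> - 1) * 2 \<le> (golden * \<sigma> - 1) * real (a (Suc t))"
      using g assms by (intro mult_left_mono) auto
    finally show ?thesis by (simp add: algebra_simps)
  qed
  have "(real (a (Suc t)) + \<sigma>) * real (cf_den a (Suc t)) + 1 * real (cf_den a t)
     \<le> (golden * (\<sigma> * real (a (Suc t)) + 1 - \<sigma>)) * real (cf_den a (Suc t)) + (golden * \<sigma>) * real (cf_den a t)"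
    using 1 g by (intro add_mono mult_right_mono) auto
  also have "\<dots> = golden * ((\<sigma> * real (a (Suc t)) + 1 - \<sigma>) * real (cf_den a (Suc t)) + \<sigma> * real (cf_den a t))"
    by (simp only: algebra_simps)
  finally show ?thesis
    unfolding lev_Suc using weight_pos[of "a (Suc t)"] cum_weight_pos[of a t]
    by (intro divide_right_mono) auto
qed

text \<open>By \<open>lev2_eq\<close> this compares the actual entry with a hypothetical
  \<open>n\<close>, one assumption for the coefficient of each denominator.\<close>

lemma lev_step_intermediate:
  assumes "2 \<le> a (Suc t)" "a (Suc t) < n"
    and g: "0 \<le> g" "g * (real n + \<sigma>) * weight n (a (Suc t)) \<le> (real (a (Suc t)) + \<sigma>) * weight n n"
    "g * weight n (a (Suc t)) \<le> weight n n"
  shows "g * lev2 a t \<le> lev1 a (Suc t)"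
proof -
  let ?k = "a (Suc t)"
  have "g * ((real n + \<sigma>) * real (cf_den a (Suc t)) + real (cf_den a t)) * weight n ?k
      = (g * (real n + \<sigma>) * weight n ?k) * real (cf_den a (Suc t)) + (g * weight n ?k) * real (cf_den a t)"
    by (simp only: algebra_simps)
  also have "\<dots> \<le> ((real ?k + \<sigma>) * weight n n) * real (cf_den a (Suc t)) + weight n n * real (cf_den a t)"
    using g by (intro add_mono mult_right_mono) auto
  also have "\<dots> = ((real ?k + \<sigma>) * real (cf_den a (Suc t)) + real (cf_den a t)) * weight n n"
    by (simp only: algebra_simps)
  finally have "g * (((real n + \<sigma>) * real (cf_den a (Suc t)) + real (cf_den a t)) / weight n n)
      \<le> ((real ?k + \<sigma>) * real (cf_den a (Suc t)) + real (cf_den a t)) / weight n ?k"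
    using weight_pos[of n] weight_pos[of ?k] by (simp add: divide_simps mult_ac)
  hence "g * (((real n + \<sigma>) * real (cf_den a (Suc t)) + real (cf_den a t)) / weight n n) / cum_weight a t
      \<le> ((real ?k + \<sigma>) * real (cf_den a (Suc t)) + real (cf_den a t)) / weight n ?k / cum_weight a t"
    using cum_weight_pos[of a t] by (intro divide_right_mono) auto
  thus ?thesis unfolding lev2_eq lev_Suc by simp
qed

lemma lev2_nonneg: "0 \<le> lev2 a t"
  unfolding lev2_def using golden_bounds skew_bounds cum_weight_pos[of a t]
  by (intro divide_nonneg_pos mult_nonneg_nonneg add_nonneg_nonneg) auto

lemma lev1_nonneg: "0 \<le> lev1 a t"
  unfolding lev1_def using skew_bounds cum_weight_pos[of a t]
  by (intro divide_nonneg_pos mult_nonneg_nonneg add_nonneg_nonneg) auto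

definition lev_min :: "(nat \<Rightarrow> nat) \<Rightarrow> nat \<Rightarrow> real" where
  "lev_min a t = min (lev1 a t) (lev2 a t)"

lemma lev_min_0: "(1 / 2) < lev_min a 0"
proof -
  have "(8 / 5) * (17 / 20) \<le> golden * \<sigma>" using golden_bounds skew_bounds by (intro mult_mono) auto
  thus ?thesis by (simp add: lev_min_def lev1_def lev2_def cum_weight_def)
qed

lemma convex_golden: "g \<le> u \<Longrightarrow> g \<le> v \<Longrightarrow> g \<le> u / golden + v / golden ^ 2"
proof -
  assume "g \<le> u" "g \<le> v"
  have "g = g * (1 / golden + 1 / golden ^ 2)" by (simp add: golden_inverse)
  also have "\<dots> = g / golden + g / golden ^ 2" by (simp add: algebra_simps)
  also have "\<dots> \<le> u / golden + v / golden ^ 2"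
    using \<open>g \<le> u\<close> \<open>g \<le> v\<close> golden_bounds by (intro add_mono divide_right_mono) auto
  finally show ?thesis .
qed

lemma convex_golden_upper: "u \<le> g \<Longrightarrow> v \<le> g \<Longrightarrow> u / golden + v / golden ^ 2 \<le> g"
proof -
  assume "u \<le> g" "v \<le> g"
  have "u / golden + v / golden ^ 2 \<le> g / golden + g / golden ^ 2"
    using \<open>u \<le> g\<close> \<open>v \<le> g\<close> golden_bounds by (intro add_mono divide_right_mono) auto
  also have "\<dots> = g * (1 / golden + 1 / golden ^ 2)" by (simp add: algebra_simps)
  also have "\<dots> = g" by (simp add: golden_inverse)
  finally show ?thesis .
qed

text \<open>After an entry above \<open>1\<close> the new minimum is at least the old
  \<open>lev2\<close>, so gains are measured against \<open>lev2\<close>.\<close>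

lemma lev_min_growth:
  obtains g where "1 < g"
    "\<And>a t. 1 \<le> a (Suc t) \<Longrightarrow> a (Suc t) \<le> n \<Longrightarrow> lev_min a t \<le> lev_min a (Suc t)"
    "\<And>a t. 2 \<le> a (Suc t) \<Longrightarrow> a (Suc t) < n \<Longrightarrow> g * lev_min a t \<le> lev_min a (Suc t)"
    "\<And>a t. a (Suc t) = n \<Longrightarrow> a (Suc (Suc t)) = n \<Longrightarrow> g * lev_min a t \<le> lev_min a (Suc (Suc t))"
    "\<And>a t. a (Suc t) = n \<Longrightarrow> a (Suc (Suc t)) = 1 \<Longrightarrow> a (Suc (Suc (Suc t))) = 1 \<Longrightarrow>
       g * lev_min a t \<le> lev_min a (Suc (Suc (Suc t)))"
proof -
  obtain g where g: "1 < g" "g \<le> (51 / 50)"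
    "\<And>k. 2 \<le> k \<Longrightarrow> k < n \<Longrightarrow> g * (real n + \<sigma>) * weight n k \<le> (real k + \<sigma>) * weight n n"
    "\<And>k. 2 \<le> k \<Longrightarrow> k < n \<Longrightarrow> g * weight n k \<le> weight n n"
    by (rule ex_uniform_gain) blast
  have lev_min_le: "lev_min a t \<le> lev2 a t" for a t by (simp add: lev_min_def)
  show ?thesis
  proof
    show "1 < g" by (rule g)
    show G: "g * lev_min a t \<le> lev_min a (Suc t)" if "2 \<le> a (Suc t)" "a (Suc t) < n" for a t
    proof -
      have "g * lev_min a t \<le> g * lev2 a t" using g lev_min_le by (intro mult_left_mono) auto
      also have "\<dots> \<le> lev1 a (Suc t)" using that g by (intro lev_step_intermediate) auto
      finally show ?thesis using lev1_le_lev2_step[of a t] that by (simp add: lev_min_def)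
    qed
    have N: "lev2 a t \<le> lev_min a (Suc t)" if "a (Suc t) = n" for a t
      using lev1_step_n[of a t] lev1_le_lev2_step[of a t] that n by (simp add: lev_min_def)
    show "g * lev_min a t \<le> lev_min a (Suc (Suc t))" if "a (Suc t) = n" "a (Suc (Suc t)) = n" for a t
    proof -
      have "g * lev_min a t \<le> (11 / 10) * lev2 a t"
        using g lev_min_le lev1_nonneg lev2_nonneg by (intro mult_mono') (auto simp: lev_min_def)
      also have "\<dots> \<le> lev2 a (Suc t)" using that by (intro lev2_step_n)
      also have "\<dots> \<le> lev_min a (Suc (Suc t))" using that by (intro N)
      finally show ?thesis .
    qed
    show "lev_min a t \<le> lev_min a (Suc t)" if le: "1 \<le> a (Suc t)" "a (Suc t) \<le> n" for a t
    proof -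
      consider "a (Suc t) = 1" | "2 \<le> a (Suc t)" "a (Suc t) < n" | "a (Suc t) = n"
        using le by linarith
      thus ?thesis
      proof cases
        case 1
        thus ?thesis
          using convex_golden[of "lev_min a t" "lev1 a t" "lev2 a t"] lev_step_1[of a t, OF 1]
          by (simp add: lev_min_def)
      next
        case 2
        hence "g * lev_min a t \<le> lev_min a (Suc t)" by (rule G)
        moreover have "1 * lev_min a t \<le> g * lev_min a t"
          using g lev2_nonneg[of a t] lev1_nonneg[of a t]
          by (intro mult_right_mono) (auto simp: lev_min_def)
        ultimately show ?thesis by simp
      next
        case 3
        thus ?thesis using N lev_min_le order_trans by blast
      qed
    qed
    show "g * lev_min a t \<le> lev_min a (Suc (Suc (Suc t)))"
      if "a (Suc t) = n" "a (Suc (Suc t)) = 1" "a (Suc (Suc (Suc t))) = 1" for a t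
    proof -
      \<comment> \<open>After \<open>n\<close> the values are \<open>b\<close> and at least
        \<open>(11 / 10) * b\<close>. The first \<open>1\<close> mixes them to at least
        \<open>u\<close>, the second mixes that with \<open>b\<close>; the smaller surplus
        \<open>(1 / 10) / golden ^ 3\<close> exceeds \<open>1 / 50\<close>, hence the cap on
        \<open>g\<close>.\<close>
      define b where "b = lev2 a t"
      have b: "0 \<le> b" unfolding b_def by (rule lev2_nonneg)
      define u where "u = b / golden + (11 / 10) * b / golden ^ 2"
      have "u \<le> lev1 a (Suc t) / golden + lev2 a (Suc t) / golden ^ 2"
        unfolding u_def b_def lev1_step_n[of a t, OF that(1)]
          using lev2_step_n[of a t, OF that(1)] golden_bounds
        by (intro add_mono divide_right_mono) auto
      hence 1: "u \<le> lev1 a (Suc (Suc t))" using lev_step_1[of a "Suc t"] that by simp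
      have 2: "lev2 a (Suc (Suc t)) = b"
        using lev_step_1[of a "Suc t"] lev1_step_n[of a t] that by (simp add: b_def)
      have gb: "golden ^ 2 \<le> (131 / 50)" "golden ^ 3 \<le> (106 / 25)"
        using golden_sq golden_bounds by (simp_all add: power3_eq_cube power2_eq_square algebra_simps)
      have u: "u = b * (1 + (1 / 10) / golden ^ 2)"
      proof -
        have "u = b * (1 / golden + 1 / golden ^ 2 + (1 / 10) / golden ^ 2)"
          by (simp add: u_def algebra_simps)
        thus ?thesis by (simp only: golden_inverse)
      qed
      have "(1 / 10) / (131 / 50) \<le> (1 / 10) / golden ^ 2"
        using gb golden_bounds by (intro divide_left_mono) auto
      hence "g * b \<le> (1 + (1 / 10) / golden ^ 2) * b" using g b by (intro mult_right_mono) auto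
      hence gu: "g * b \<le> u" unfolding u by (simp add: mult.commute)
      have "(1 / 10) / (106 / 25) \<le> (1 / 10) / golden ^ 3"
        using gb golden_bounds by (intro divide_left_mono) auto
      hence "g * b \<le> (1 + (1 / 10) / golden ^ 3) * b" using g b by (intro mult_right_mono) auto
      also have "\<dots> = u / golden + b / golden ^ 2"
      proof -
        have "u / golden + b / golden ^ 2 = b * (1 / golden + 1 / golden ^ 2 + (1 / 10) / golden ^ 3)"
          unfolding u using golden_bounds by (simp add: field_simps power3_eq_cube power2_eq_square)
        thus ?thesis by (simp only: golden_inverse) simp
      qed
      also have "\<dots> \<le> lev1 a (Suc (Suc (Suc t)))"
        using lev_step_1[of a "Suc (Suc t)"] that 1 2 golden_bounds by (simp add: divide_right_mono)
      finally have "g * b \<le> lev_min a (Suc (Suc (Suc t)))"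
        using gu 1 lev_step_1[of a "Suc (Suc t)"] that by (simp add: lev_min_def)
      moreover have "g * lev_min a t \<le> g * b"
        unfolding b_def using g lev_min_le by (intro mult_left_mono) auto
      ultimately show ?thesis by linarith
    qed
  qed
qed

text \<open>If \<open>lev_min\<close> stays bounded, then only finitely many steps gain the factor \<open>g\<close>.\<close>

lemma bounded_lev_min_eventually_periodic:
  assumes a: "\<And>j. 1 \<le> j \<Longrightarrow> 1 \<le> a j \<and> a j \<le> n"
    and bdd: "\<And>t. lev_min a t \<le> K"
  obtains T where "\<And>t. T \<le> t \<Longrightarrow> a t = 1"
    | T where "a T = n" "\<And>t. T \<le> t \<Longrightarrow> a t = n \<Longrightarrow> a (Suc t) = 1 \<and> a (Suc (Suc t)) = n"
proof -
  obtain g where g: "1 < g"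
    "\<And>a t. 1 \<le> a (Suc t) \<Longrightarrow> a (Suc t) \<le> n \<Longrightarrow> lev_min a t \<le> lev_min a (Suc t)"
    "\<And>a t. 2 \<le> a (Suc t) \<Longrightarrow> a (Suc t) < n \<Longrightarrow> g * lev_min a t \<le> lev_min a (Suc t)"
    "\<And>a t. a (Suc t) = n \<Longrightarrow> a (Suc (Suc t)) = n \<Longrightarrow> g * lev_min a t \<le> lev_min a (Suc (Suc t))"
    "\<And>a t. a (Suc t) = n \<Longrightarrow> a (Suc (Suc t)) = 1 \<Longrightarrow> a (Suc (Suc (Suc t))) = 1 \<Longrightarrow>
       g * lev_min a t \<le> lev_min a (Suc (Suc (Suc t)))"
    by (rule lev_min_growth) blast
  have inc: "incseq (lev_min a)" by (rule incseq_SucI, rule g(2)) (use a in auto)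
  then obtain L where L: "lev_min a \<longlonglongrightarrow> L" "\<And>t. lev_min a t \<le> L"
    using incseq_convergent[of "lev_min a" K] bdd by blast
  have "0 < L" using L(2)[of 0] lev_min_0[of a] by linarith
  hence "L / g < L" using g by (simp add: field_simps)
  \<comment> \<open>From here on a gain by \<open>g\<close> would lift \<open>lev_min\<close> above
    its limit \<open>L\<close>.\<close>
  then obtain T where T: "\<And>t. T \<le> t \<Longrightarrow> L / g < lev_min a t"
    using order_tendstoD(1)[OF L(1)] unfolding eventually_sequentially by blast
  have nogain: "\<not> g * lev_min a t \<le> lev_min a t'" if "T \<le> t" for t t'
    using T[OF that] L(2)[of t'] g by (simp add: field_simps)
  have dich: "a t = 1 \<or> a t = n" if t: "Suc T \<le> t" for t
  proof -
    obtain s where s: "t = Suc s" "T \<le> s" using t by (cases t) auto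
    show ?thesis using nogain[OF s(2), of t] g(3)[of a s] a[of t] s(1) by fastforce
  qed
  show ?thesis
  proof (cases "\<exists>t\<ge>Suc T. a t = n")
    case True
    then obtain t0 where t0: "Suc T \<le> t0" "a t0 = n" by blast
    have "a (Suc t) = 1 \<and> a (Suc (Suc t)) = n" if t: "t0 \<le> t" "a t = n" for t
    proof -
      obtain s where s: "t = Suc s" "T \<le> s" using t t0 by (cases t) auto
      have "a (Suc t) \<noteq> n" using nogain[OF s(2)] g(4)[of a s] t s by blast
      hence 1: "a (Suc t) = 1" using dich[of "Suc t"] t t0 by simp
      have "a (Suc (Suc t)) \<noteq> 1" using nogain[OF s(2)] g(5)[of a s] t s 1 by blast
      thus ?thesis using 1 dich[of "Suc (Suc t)"] t t0 by simp
    qed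
    thus ?thesis using that(2) t0 by blast
  next
    case False
    thus ?thesis using dich that(1) by blast
  qed
qed

section \<open>From the functionals to the ratio\<close>

definition excess :: "(nat \<Rightarrow> nat) \<Rightarrow> nat \<Rightarrow> real" where
  "excess a t = real (partial_sum a t) - \<kappa> * real t"

lemma excess_Suc: "excess a (Suc t) = excess a t + (real (a (Suc t)) - \<kappa>)"
  by (simp add: excess_def algebra_simps)

text \<open>The square of \<open>cum_weight\<close> is \<open>2 ^ S\<close> times an exponential of
  the excess, so an upper bound on the excess turns lower bounds for the functionals into lower
  bounds for \<open>ratio\<close>.\<close>

lemma ratio_eq:
  "ratio a t = (real (cf_den a (Suc t)) / cum_weight a t) ^ 2 * exp (- 2 * \<beta> * excess a t)"
proof -
  have "cum_weight a t ^ 2 = exp (real (partial_sum a t) * ln 2 - 2 * \<beta> * excess a t)"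
    unfolding cum_weight_eq excess_def by (simp add: power2_eq_square ln_sqrt algebra_simps flip: exp_add)
  also have "\<dots> = exp (real (partial_sum a t) * ln 2) * exp (- 2 * \<beta> * excess a t)"
    by (simp flip: exp_add)
  also have "exp (real (partial_sum a t) * ln 2) = 2 ^ partial_sum a t"
    by (simp add: exp_of_nat_mult)
  finally have W: "cum_weight a t ^ 2 = 2 ^ partial_sum a t * exp (- 2 * \<beta> * excess a t)" .
  show ?thesis unfolding ratio_def power_divide W by simp
qed

lemma ratio_le: "ratio a t \<le> lev1 a t ^ 2 * exp (- 2 * \<beta> * excess a t)"
proof -
  have "real (cf_den a (Suc t)) / cum_weight a t \<le> lev1 a t"
    unfolding lev1_def using skew_bounds cum_weight_pos[of a t] by (intro divide_right_mono) auto
  thus ?thesis unfolding ratio_eq using cum_weight_pos[of a t]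
    by (intro mult_right_mono power_mono) auto
qed

lemma ratio_ge:
  assumes "\<And>j. 1 \<le> j \<Longrightarrow> 1 \<le> a j"
  shows "(lev_min a t / 2) ^ 2 * exp (- 2 * \<beta> * excess a t) \<le> ratio a t"
proof -
  have "real (cf_den a t) \<le> real (cf_den a (Suc t))" using cf_den_mono[of a t, OF assms] by simp
  hence "\<sigma> * real (cf_den a t) \<le> 1 * real (cf_den a (Suc t))"
    using skew_bounds by (intro mult_mono) auto
  hence "lev1 a t \<le> (2 * real (cf_den a (Suc t))) / cum_weight a t"
    unfolding lev1_def using cum_weight_pos[of a t] by (intro divide_right_mono) auto
  hence "lev_min a t / 2 \<le> real (cf_den a (Suc t)) / cum_weight a t"
    unfolding lev_min_def by (simp add: min_le_iff_disj field_simps)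
  moreover have "0 \<le> lev_min a t / 2"
    using lev1_nonneg[of a t] lev2_nonneg[of a t] by (simp add: lev_min_def)
  ultimately show ?thesis unfolding ratio_eq by (intro mult_right_mono power_mono) auto
qed

lemma lev_min_incseq:
  assumes "\<And>j. 1 \<le> j \<Longrightarrow> 1 \<le> a j \<and> a j \<le> n"
  shows "incseq (lev_min a)"
proof -
  obtain g :: real where "\<And>a t. 1 \<le> a (Suc t) \<Longrightarrow> a (Suc t) \<le> n \<Longrightarrow> lev_min a t \<le> lev_min a (Suc t)"
    by (rule lev_min_growth) blast
  thus ?thesis using assms by (intro incseq_SucI) auto
qed

lemma excess_ones:
  assumes "\<And>j. T < j \<Longrightarrow> a j = 1" "T \<le> t"
  shows "excess a t = excess a T - (\<kappa> - 1) * real (t - T)"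
  using assms(2)
proof (induction t rule: dec_induct)
  case (step t)
  thus ?case using assms(1)[of "Suc t"] by (simp add: excess_Suc Suc_diff_le algebra_simps)
qed simp

lemma excess_ones_unbounded:
  assumes "\<And>j. T < j \<Longrightarrow> a j = 1"
  shows "filterlim (\<lambda>t. - excess a t) at_top sequentially"
proof -
  have "filterlim (\<lambda>t. (- excess a T - (\<kappa> - 1) * real T) + (\<kappa> - 1) * real t) at_top sequentially"
    using kappa_bounds
    by (intro filterlim_tendsto_add_at_top[OF tendsto_const]
        filterlim_tendsto_pos_mult_at_top[OF tendsto_const _ filterlim_real_sequentially]) auto
  moreover have "\<forall>\<^sub>F t in sequentially.
      - excess a t = (- excess a T - (\<kappa> - 1) * real T) + (\<kappa> - 1) * real t"
    using eventually_ge_at_top[of T]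
  proof eventually_elim
    case (elim t)
    thus ?case using excess_ones[of T a t, OF assms] by (simp add: of_nat_diff algebra_simps)
  qed
  ultimately show ?thesis by (subst filterlim_cong[OF refl refl])
qed

text \<open>\<open>lev_min\<close> stays above \<open>1 / 2\<close>, while the excess loses
  \<open>kappa n - 1 > 0\<close> per entry.\<close>

lemma ratio_ones_at_top:
  assumes a: "\<And>j. 1 \<le> j \<Longrightarrow> 1 \<le> a j \<and> a j \<le> n" and "\<And>j. T < j \<Longrightarrow> a j = 1"
  shows "filterlim (ratio a) at_top sequentially"
proof (rule filterlim_at_top_mono)
  have "filterlim (\<lambda>t. (2 * \<beta>) * - excess a t) at_top sequentially"
    using tilt_pos excess_ones_unbounded[of T a, OF assms(2)]
    by (intro filterlim_tendsto_pos_mult_at_top[OF tendsto_const]) auto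
  hence "filterlim (\<lambda>t. exp ((2 * \<beta>) * - excess a t)) at_top sequentially"
    by (rule filterlim_compose[OF exp_at_top])
  hence "filterlim (\<lambda>t. exp (- 2 * \<beta> * excess a t)) at_top sequentially" by simp
  thus "filterlim (\<lambda>t. (1 / 4) ^ 2 * exp (- 2 * \<beta> * excess a t)) at_top sequentially"
    by (intro filterlim_tendsto_pos_mult_at_top[OF tendsto_const]) auto
  show "\<forall>\<^sub>F t in sequentially. (1 / 4) ^ 2 * exp (- 2 * \<beta> * excess a t) \<le> ratio a t"
  proof (intro always_eventually allI)
    fix t
    have "1 / 4 \<le> lev_min a t / 2"
      using lev_min_0[of a] incseqD[OF lev_min_incseq[of a, OF a], of 0 t] by simp
    hence "(1 / 4) ^ 2 * exp (- 2 * \<beta> * excess a t) \<le> (lev_min a t / 2) ^ 2 * exp (- 2 * \<beta> * excess a t)"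
      by (intro mult_right_mono power_mono) auto
    also have "\<dots> \<le> ratio a t" using a by (intro ratio_ge) auto
    finally show "(1 / 4) ^ 2 * exp (- 2 * \<beta> * excess a t) \<le> ratio a t" .
  qed
qed

lemma ratio_at_top:
  assumes a: "\<And>j. 1 \<le> j \<Longrightarrow> 1 \<le> a j \<and> a j \<le> n"
    and C: "\<And>t. 1 \<le> t \<Longrightarrow> excess a t \<le> C"
  shows "filterlim (ratio a) at_top sequentially"
proof (cases "\<exists>K. \<forall>t. lev_min a t \<le> K")
  case True
  then obtain K where K: "\<And>t. lev_min a t \<le> K" by blast
  show ?thesis
  proof (rule bounded_lev_min_eventually_periodic[of a K, OF a K])
    fix T assume "\<And>t. T \<le> t \<Longrightarrow> a t = 1"
    thus ?thesis using ratio_ones_at_top[of a T] a by simp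
  next
    fix T assume T: "a T = n" "\<And>t. T \<le> t \<Longrightarrow> a t = n \<Longrightarrow> a (Suc t) = 1 \<and> a (Suc (Suc t)) = n"
    \<comment> \<open>Each period \<open>1, n\<close> adds \<open>n + 1 - 2 * kappa n > 0\<close> to
      the excess, which then cannot stay below \<open>C\<close>.\<close>
    have alt: "a (T + 2 * i) = n \<and> excess a (T + 2 * i) = excess a T + real i * (real n + 1 - 2 * \<kappa>)" for i
    proof (induction i)
      case (Suc i)
      thus ?case using T(2)[of "T + 2 * i"] by (simp add: excess_Suc algebra_simps)
    qed (simp add: T)
    define d where "d = real n + 1 - 2 * \<kappa>"
    have d: "d > 0" using kappa_bounds by (simp add: d_def)
    obtain i where i: "(C - excess a T) / d < real i" using reals_Archimedean2 by blast
    have "(C - excess a T) / d < real (Suc i)" using i by simp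
    hence "C < excess a (T + 2 * Suc i)" using alt[of "Suc i"] d unfolding d_def[symmetric]
      by (simp add: pos_divide_less_eq del: of_nat_Suc)
    thus ?thesis using C[of "T + 2 * Suc i"] by simp
  qed
next
  case False
  define c where "c = exp (- 2 * \<beta> * C)"
  have "\<forall>\<^sub>F t in sequentially. Z \<le> ratio a t" for Z
  proof -
    define Y where "Y = max 1 (Z / c)"
    obtain T where "\<not> lev_min a T \<le> 2 * Y" using False by blast
    hence T: "2 * Y < lev_min a t" if "T \<le> t" for t
      using incseqD[OF lev_min_incseq[of a, OF a], of T t] that by simp
    show ?thesis
    proof (intro eventually_sequentiallyI)
      fix t assume t: "max 1 T \<le> t"
      have "Z \<le> Y * c" by (simp add: Y_def c_def max_def field_simps)
      also have "Y * 1 \<le> Y * Y" by (intro mult_left_mono) (auto simp: Y_def)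
      hence "Y * c \<le> Y ^ 2 * c" by (intro mult_right_mono) (auto simp: c_def power2_eq_square)
      also have "\<dots> \<le> (lev_min a t / 2) ^ 2 * exp (- 2 * \<beta> * excess a t)"
        unfolding c_def using T[of t] t C[of t] tilt_pos
        by (intro mult_mono power_mono) (auto simp: Y_def)
      also have "\<dots> \<le> ratio a t" using a by (intro ratio_ge) auto
      finally show "Z \<le> ratio a t" .
    qed
  qed
  thus ?thesis by (simp add: filterlim_at_top)
qed

end

section \<open>Difference quotients and the denominators of convergents\<close>

context unit_irrational
begin

context
  fixes n :: nat
  assumes bounded: "\<And>j. 1 \<le> j \<Longrightarrow> a j \<le> n"
begin

lemma q_Suc_le: "q (Suc t) \<le> (real n + 1) * q t"
proof -
  have "real (cf_den a (Suc (Suc t))) \<le> real ((n + 1) * cf_den a (Suc t))"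
    using cf_den_le[of a n t] a_ge_1 bounded of_nat_mono by blast
  also have "\<dots> = (real n + 1) * real (cf_den a (Suc t))"
    by (simp add: algebra_simps del: cf_den.simps)
  finally show ?thesis unfolding q_def .
qed

lemma ratio_q: "ratio a t = q t ^ 2 / 2 ^ S t"
  by (simp add: ratio_def q_def)

lemma power_S_bounds: "2 * 2 ^ S t \<le> (2::real) ^ S (Suc t)" "(2::real) ^ S (Suc t) \<le> 2 ^ n * 2 ^ S t"
proof -
  have "(2::real) ^ Suc (S t) \<le> 2 ^ S (Suc t)"
    using a_ge_1[of "Suc t"] by (intro power_increasing) auto
  thus "2 * 2 ^ S t \<le> (2::real) ^ S (Suc t)" by simp
  have "(2::real) ^ S (Suc t) \<le> 2 ^ (n + S t)"
    using bounded[of "Suc t"] by (intro power_increasing) auto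
  thus "(2::real) ^ S (Suc t) \<le> 2 ^ n * 2 ^ S t" by (simp add: power_add)
qed

lemma convergent_quotient_bounds:
  defines "d \<equiv> \<lambda>t. convergent_of a t - x"
  shows "(question_mark (x + d t) - question_mark x) / d t \<le> 2 * (real n + 1) * ratio a t"
    and "ratio a t / 2 ^ n \<le> (question_mark (x + d t) - question_mark x) / d t"
proof -
  define F where "F = question_mark (convergent_of a t) - question_mark x"
  have dt: "\<bar>d t\<bar> = \<bar>x - convergent_of a t\<bar>" by (simp add: d_def abs_minus_commute)
  have d0: "0 < \<bar>d t\<bar>" unfolding dt abs_x_minus_convergent by (rule convergent_side)
  have eq: "(question_mark (x + d t) - question_mark x) / d t = \<bar>F\<bar> / \<bar>d t\<bar>"
  proof -
    have "0 < ((-1) ^ t * (x - convergent_of a t)) * ((-1) ^ t * (question_mark x - question_mark (convergent_of a t)))"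
      by (intro mult_pos_pos convergent_side question_mark_side)
    also have "\<dots> = ((-1) ^ t * (-1) ^ t) * (d t * F)" by (simp add: d_def F_def algebra_simps)
    also have "(-1::real) ^ t * (-1) ^ t = 1" by (simp flip: power_mult_distrib)
    finally have "0 < F / d t" by (auto simp: zero_less_mult_iff zero_less_divide_iff)
    hence "F / d t = \<bar>F\<bar> / \<bar>d t\<bar>" by (metis abs_divide abs_of_pos)
    thus ?thesis by (simp add: F_def d_def)
  qed
  have qp: "0 < q t" "0 < q (Suc t)" using q_pos by auto
  have "\<bar>F\<bar> / \<bar>d t\<bar> \<le> (2 / 2 ^ S (Suc t)) / (1 / (2 * q t * q (Suc t)))"
    using abs_question_mark_diff_le[of t] abs_x_minus_convergent_ge[of t] qp d0
    unfolding dt F_def by (intro frac_le) auto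
  also have "\<dots> = 4 * q t * q (Suc t) / 2 ^ S (Suc t)" by simp
  also have "\<dots> \<le> 4 * q t * ((real n + 1) * q t) / (2 * 2 ^ S t)"
    using power_S_bounds[of t] q_Suc_le[of t] qp by (intro frac_le mult_left_mono) auto
  also have "\<dots> = 2 * (real n + 1) * ratio a t" by (simp add: ratio_q power2_eq_square)
  finally show "(question_mark (x + d t) - question_mark x) / d t \<le> 2 * (real n + 1) * ratio a t"
    unfolding eq .
  have "ratio a t / 2 ^ n = q t * q t / (2 ^ n * 2 ^ S t)" by (simp add: ratio_q power2_eq_square)
  also have "\<dots> \<le> q t * q (Suc t) / 2 ^ S (Suc t)"
    using power_S_bounds[of t] q_mono[of t] qp by (intro frac_le mult_left_mono) auto
  also have "\<dots> = (1 / 2 ^ S (Suc t)) / (1 / (q t * q (Suc t)))" by simp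
  also have "\<dots> \<le> \<bar>F\<bar> / \<bar>d t\<bar>"
    using abs_question_mark_diff_ge[of t] abs_x_minus_convergent_le[of t] qp d0
    unfolding dt F_def by (intro frac_le) auto
  finally show "ratio a t / 2 ^ n \<le> (question_mark (x + d t) - question_mark x) / d t"
    unfolding eq .
qed

text \<open>Difference quotients at convergents suffice: they return below
  \<open>2 * (n + 1)\<close> again and again and also exceed every bound.\<close>

lemma not_extended_differentiable:
  assumes small: "\<exists>\<^sub>F t in sequentially. ratio a t \<le> 1"
    and large: "\<And>K. \<exists>\<^sub>F t in sequentially. K \<le> ratio a t"
  shows "\<not> extended_differentiable question_mark x"
proof
  assume "extended_differentiable question_mark x"
  then obtain l where "((\<lambda>\<delta>. ereal ((question_mark (x + \<delta>) - question_mark x) / \<delta>)) \<longlongrightarrow> l) (at 0)"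
    unfolding extended_differentiable_def has_extended_derivative_def by blast
  moreover have "filterlim (\<lambda>t. convergent_of a t - x) (at 0) sequentially"
    unfolding filterlim_at
  proof
    show "(\<lambda>t. convergent_of a t - x) \<longlonglongrightarrow> 0" by (rule LIM_zero[OF convergent_of_tendsto])
    have "convergent_of a t - x \<noteq> 0" for t using convergent_side[of t] by auto
    thus "\<forall>\<^sub>F t in sequentially. convergent_of a t - x \<in> UNIV \<and> convergent_of a t - x \<noteq> 0"
      by (intro always_eventually) blast
  qed
  ultimately have L: "(\<lambda>t. ereal ((question_mark (x + (convergent_of a t - x)) - question_mark x)
      / (convergent_of a t - x))) \<longlonglongrightarrow> l" (is "?D \<longlonglongrightarrow> l")
    by (rule filterlim_compose)
  define B where "B = 2 * (real n + 1)"
  have "l \<le> ereal B"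
  proof (rule ccontr)
    assume "\<not> l \<le> ereal B"
    hence "\<forall>\<^sub>F t in sequentially. ereal B < ?D t" by (intro order_tendstoD(1)[OF L]) simp
    with small have "\<exists>\<^sub>F t in sequentially. ratio a t \<le> 1 \<and> ereal B < ?D t"
      by (rule frequently_eventually_frequently)
    from frequently_ex[OF this] obtain t where t: "ratio a t \<le> 1" "ereal B < ?D t" by blast
    have "B * ratio a t \<le> B * 1" using t(1) by (intro mult_left_mono) (auto simp: B_def)
    thus False using t(2) convergent_quotient_bounds(1)[of t] unfolding B_def[symmetric] by simp
  qed
  hence "l < ereal (B + 1)" by (rule order_le_less_trans) simp
  hence "\<forall>\<^sub>F t in sequentially. ?D t < ereal (B + 1)" by (rule order_tendstoD(2)[OF L])
  with large have "\<exists>\<^sub>F t in sequentially. (B + 1) * 2 ^ n \<le> ratio a t \<and> ?D t < ereal (B + 1)"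
    by (rule frequently_eventually_frequently)
  from frequently_ex[OF this] obtain t where t: "(B + 1) * 2 ^ n \<le> ratio a t" "?D t < ereal (B + 1)"
    by blast
  have "B + 1 \<le> ratio a t / 2 ^ n" using t(1) by (simp add: pos_le_divide_eq)
  thus False using t(2) convergent_quotient_bounds(2)[of t] by simp
qed

text \<open>For small \<open>\<delta>\<close> take the first convergent \<open>s\<close> between
  \<open>x\<close> and \<open>x + \<delta>\<close>. By monotonicity the increment is at least the
  one up to \<open>s\<close>, while \<open>\<delta>\<close> is shorter than the distance to
  convergent \<open>s - 2\<close> on the same side.\<close>

lemma question_mark_derivative_infinite:
  assumes "filterlim (ratio a) at_top sequentially"
  shows "has_extended_derivative question_mark x \<infinity>"
  unfolding has_extended_derivative_def tendsto_PInfty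
proof
  fix K :: real
  \<comment> \<open>\<open>(n + 1) ^ 3\<close> passes from \<open>q s ^ 2\<close> to
    \<open>q r * q (Suc r)\<close> with \<open>s = r + 2\<close>, and \<open>2 ^ n\<close> from
    \<open>S s\<close> to \<open>S (Suc s)\<close>.\<close>
  define c where "c = (real n + 1) ^ 3 * 2 ^ n"
  have c: "c > 0" by (simp add: c_def)
  obtain s0 where s0: "\<And>s. s0 \<le> s \<Longrightarrow> (K + 1) * c \<le> ratio a s"
    using assms unfolding filterlim_at_top eventually_sequentially by blast
  \<comment> \<open>\<open>x\<close> and \<open>1 - x\<close> keep \<open>x + \<delta>\<close> in
    the unit interval; the distances to early convergents force the chosen index beyond
    \<open>Suc s0\<close>.\<close>
  define A where "A = {x, 1 - x} \<union> (\<lambda>t. \<bar>x - convergent_of a t\<bar>) ` {..Suc s0}"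
  define d where "d = Min A"
  have "finite A" "A \<noteq> {}" by (auto simp: A_def)
  moreover have "0 < v" if "v \<in> A" for v
  proof -
    have "0 < \<bar>x - convergent_of a t\<bar>" for t
      unfolding abs_x_minus_convergent by (rule convergent_side)
    thus ?thesis
      using that unit unfolding A_def by (elim UnE insertE imageE emptyE) (simp_all only:, auto)
  qed
  ultimately have d: "0 < d" by (simp add: d_def)
  have "d \<le> v" if "v \<in> A" for v unfolding d_def using \<open>finite A\<close> that by (rule Min_le)
  hence d_le: "d \<le> x" "d \<le> 1 - x" "\<And>t. t \<le> Suc s0 \<Longrightarrow> d \<le> \<bar>x - convergent_of a t\<bar>"
    unfolding A_def by blast+
  have "K < (question_mark (x + \<delta>) - question_mark x) / \<delta>" if \<delta>: "\<delta> \<noteq> 0" "\<bar>\<delta>\<bar> < d" for \<delta>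
  proof -
    define P where "P = (\<lambda>s. 0 < (convergent_of a s - x) * \<delta> \<and> \<bar>x - convergent_of a s\<bar> \<le> \<bar>\<delta>\<bar>)"
    have sign: "0 < (convergent_of a s - x) * \<delta> \<longleftrightarrow> (if even s then \<delta> < 0 else 0 < \<delta>)" for s
      using convergent_side[of s] by (auto simp: zero_less_mult_iff)
    have "\<exists>s. P s"
    proof -
      have "\<forall>\<^sub>F t in sequentially. dist (convergent_of a t) x < \<bar>\<delta>\<bar>"
        using tendstoD[OF convergent_of_tendsto] \<delta> by simp
      then obtain N where N: "\<And>t. N \<le> t \<Longrightarrow> dist (convergent_of a t) x < \<bar>\<delta>\<bar>"
        unfolding eventually_sequentially by blast
      define s where "s = (if \<delta> < 0 then 2 * N else 2 * N + 1)"
      have "dist (convergent_of a s) x < \<bar>\<delta>\<bar>" by (intro N) (simp add: s_def)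
      hence "\<bar>x - convergent_of a s\<bar> \<le> \<bar>\<delta>\<bar>" by (simp add: dist_real_def abs_minus_commute)
      moreover have "0 < (convergent_of a s - x) * \<delta>" unfolding sign using \<delta> by (simp add: s_def)
      ultimately have "P s" by (simp add: P_def)
      thus ?thesis by blast
    qed
    define s where "s = (LEAST s. P s)"
    have s: "P s" unfolding s_def using \<open>\<exists>s. P s\<close> by (rule LeastI_ex)
    have "\<not> s \<le> Suc s0" using s d_le(3)[of s] \<delta> unfolding P_def by linarith
    hence "s = Suc (Suc (s - 2))" "s0 \<le> s - 2" by linarith+
    then obtain r where r: "s = Suc (Suc r)" "s0 \<le> r" by blast
    have "\<not> P r" using not_less_Least[of r P] r unfolding s_def by simp
    moreover have "0 < (convergent_of a r - x) * \<delta>" using s unfolding P_def sign r by simp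
    ultimately have "\<bar>\<delta>\<bar> < \<bar>x - convergent_of a r\<bar>" unfolding P_def by simp
    also have "\<dots> \<le> 1 / (q r * q (Suc r))" by (rule abs_x_minus_convergent_le)
    finally have dq: "\<bar>\<delta>\<bar> \<le> 1 / (q r * q (Suc r))" by simp
    define u where "u = convergent_of a s"
    have u: "u \<in> {0..1}" unfolding u_def by (rule convergent_of_unit)
    have xd: "x + \<delta> \<in> {0..1}" using \<delta> d_le(1,2) unit by (simp add: abs_less_iff)
    have mono: "question_mark v \<le> question_mark w" if "v \<in> {0..1}" "w \<in> {0..1}" "v \<le> w" for v w
      using question_mark_strict_mono[OF that(1,2)] that(3) by (cases "v = w") auto
    have "\<bar>question_mark u - question_mark x\<bar> / \<bar>\<delta>\<bar> \<le> (question_mark (x + \<delta>) - question_mark x) / \<delta>"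
    proof (cases "0 < \<delta>")
      case True
      hence "x < u" "u \<le> x + \<delta>" using s unfolding P_def u_def by (auto simp: zero_less_mult_iff)
      hence "question_mark x \<le> question_mark u" "question_mark u \<le> question_mark (x + \<delta>)"
        using mono u xd unit by auto
      thus ?thesis using True by (simp add: divide_right_mono)
    next
      case False
      hence "u < x" "x + \<delta> \<le> u" using s \<delta> unfolding P_def u_def by (auto simp: zero_less_mult_iff)
      hence "question_mark u \<le> question_mark x" "question_mark (x + \<delta>) \<le> question_mark u"
        using mono u xd unit by auto
      hence "\<bar>question_mark u - question_mark x\<bar> / - \<delta> \<le> - (question_mark (x + \<delta>) - question_mark x) / - \<delta>"
        using False by (intro divide_right_mono) auto
      thus ?thesis using False by (simp only: minus_divide_divide) (simp add: abs_of_nonpos)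
    qed
    moreover have "K < \<bar>question_mark u - question_mark x\<bar> / \<bar>\<delta>\<bar>"
    proof -
      have qp: "0 < q r" "0 < q (Suc r)" "0 < q s" using q_pos by auto
      have q1: "q s \<le> (real n + 1) * q (Suc r)" unfolding r by (rule q_Suc_le)
      also have "\<dots> \<le> (real n + 1) * ((real n + 1) * q r)" by (intro mult_left_mono q_Suc_le) auto
      finally have "q s * q s \<le> ((real n + 1) * ((real n + 1) * q r)) * ((real n + 1) * q (Suc r))"
        using q1 qp by (intro mult_mono) simp_all
      hence qq: "q s ^ 2 \<le> (real n + 1) ^ 3 * (q r * q (Suc r))"
        by (simp add: power2_eq_square power3_eq_cube mult_ac)
      have "(K + 1) * c \<le> q s ^ 2 / 2 ^ S s" using s0[of s] r unfolding ratio_q by simp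
      also have "\<dots> \<le> (real n + 1) ^ 3 * (q r * q (Suc r)) / 2 ^ S s"
        using qq by (intro divide_right_mono) auto
      also have "\<dots> = c * ((q r * q (Suc r)) / (2 ^ n * 2 ^ S s))" by (simp add: c_def)
      also have "\<dots> \<le> c * ((q r * q (Suc r)) / 2 ^ S (Suc s))"
        using power_S_bounds(2)[of s] qp c by (intro mult_left_mono divide_left_mono mult_pos_pos) simp_all
      finally have "c * (K + 1) \<le> c * ((q r * q (Suc r)) / 2 ^ S (Suc s))"
        by (simp add: mult.commute)
      hence "K + 1 \<le> (q r * q (Suc r)) / 2 ^ S (Suc s)"
        using c by (simp only: mult_le_cancel_left_pos)
      also have "\<dots> = (1 / 2 ^ S (Suc s)) / (1 / (q r * q (Suc r)))" by simp
      also have "\<dots> \<le> \<bar>question_mark u - question_mark x\<bar> / \<bar>\<delta>\<bar>"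
        using abs_question_mark_diff_ge[of s] dq \<delta> unfolding u_def by (intro frac_le) auto
      finally show ?thesis by simp
    qed
    ultimately show ?thesis by linarith
  qed
  thus "\<forall>\<^sub>F \<delta> in at 0. ereal K < ereal ((question_mark (x + \<delta>) - question_mark x) / \<delta>)"
    unfolding eventually_at using d by (intro exI[of _ d]) (simp add: dist_real_def)
qed

end

end

section \<open>Numbers with prescribed partial quotients\<close>

text \<open>The values \<open>[0; b 1, ..., b k + y]\<close> with a free tail \<open>y\<close>;
  closed tails make the sets compact.\<close>

fun cylinder :: "nat \<Rightarrow> (nat \<Rightarrow> nat) \<Rightarrow> real set" where
  "cylinder 0 b = {0..1}"
| "cylinder (Suc k) b = (\<lambda>y. 1 / (real (b 1) + y)) ` cylinder k (\<lambda>j. b (Suc j))"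

lemma cylinder_props:
  "(\<And>j. 1 \<le> j \<Longrightarrow> 1 \<le> b j) \<Longrightarrow>
     compact (cylinder k b) \<and> cylinder k b \<noteq> {} \<and> cylinder k b \<subseteq> {0..1} \<and> cylinder (Suc k) b \<subseteq> cylinder k b"
proof (induction k arbitrary: b)
  case 0
  have "1 \<le> b 1" using 0 by simp
  thus ?case by (auto simp: divide_simps)
next
  case (Suc k)
  let ?c = "\<lambda>j. b (Suc j)"
  have b1: "1 \<le> real (b 1)" using Suc.prems[of 1] by simp
  have IH: "compact (cylinder k ?c)" "cylinder k ?c \<noteq> {}" "cylinder k ?c \<subseteq> {0..1}"
    "cylinder (Suc k) ?c \<subseteq> cylinder k ?c"
    using Suc.IH[of ?c] Suc.prems by auto
  have "continuous_on (cylinder k ?c) (\<lambda>y. 1 / (real (b 1) + y))"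
    using IH(3) b1 by (intro continuous_intros) fastforce
  hence 1: "compact (cylinder (Suc k) b)" using IH(1) by (simp add: compact_continuous_image)
  have 2: "cylinder (Suc k) b \<noteq> {}" using IH(2) by simp
  have 3: "cylinder (Suc k) b \<subseteq> {0..1}"
  proof
    fix v assume "v \<in> cylinder (Suc k) b"
    then obtain y where y: "y \<in> cylinder k ?c" "v = 1 / (real (b 1) + y)" by auto
    hence "0 \<le> y" using IH(3) by auto
    hence "1 \<le> real (b 1) + y" using b1 by linarith
    thus "v \<in> {0..1}" unfolding y(2) by simp
  qed
  have 4: "cylinder (Suc (Suc k)) b \<subseteq> cylinder (Suc k) b"
    unfolding cylinder.simps(2)[of "Suc k" b] cylinder.simps(2)[of k b]
      using IH(4) by (rule image_mono)
  show ?case using 1 2 3 4 by blast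
qed

definition expansion_set :: "(nat \<Rightarrow> nat) \<Rightarrow> real set" where
  "expansion_set b = (\<Inter>k. cylinder k b)"

lemma expansion_set_nonempty:
  assumes "\<And>j. 1 \<le> j \<Longrightarrow> 1 \<le> b j"
  shows "expansion_set b \<noteq> {}"
  unfolding expansion_set_def
proof (rule compact_nest)
  note p = cylinder_props[of b, OF assms]
  show "compact (cylinder k b)" "cylinder k b \<noteq> {}" for k using p by auto
  show "cylinder l b \<subseteq> cylinder k b" if "k \<le> l" for k l
    using lift_Suc_antimono_le[of "\<lambda>k. cylinder k b" k l] p that by blast
qed

lemma expansion_set_shift:
  assumes b: "\<And>j. 1 \<le> j \<Longrightarrow> 1 \<le> b j" and x: "x \<in> expansion_set b"
  shows "0 \<le> x" "1 / x - real (b 1) \<in> expansion_set (\<lambda>j. b (Suc j))" "x \<noteq> 0"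
proof -
  have mem: "x \<in> cylinder k b" for k using x by (auto simp: expansion_set_def)
  show "0 \<le> x" using mem[of 0] by simp
  have c: "1 / x - real (b 1) \<in> cylinder k (\<lambda>j. b (Suc j)) \<and> x \<noteq> 0" for k
  proof -
    obtain y where y: "y \<in> cylinder k (\<lambda>j. b (Suc j))" "x = 1 / (real (b 1) + y)"
      using mem[of "Suc k"] by auto
    have "cylinder k (\<lambda>j. b (Suc j)) \<subseteq> {0..1}" using cylinder_props[of "\<lambda>j. b (Suc j)" k] b by simp
    hence "0 < real (b 1) + y" using y(1) b[of 1] by (auto simp: add_pos_nonneg)
    thus ?thesis using y by simp
  qed
  show "1 / x - real (b 1) \<in> expansion_set (\<lambda>j. b (Suc j))" "x \<noteq> 0"
    using c by (auto simp: expansion_set_def)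
qed

text \<open>The Gauss map performs the Euclidean algorithm, sending \<open>p / q\<close> to
  \<open>(q mod p) / p\<close>.\<close>

lemma gauss_map_rational_terminates:
  "\<lbrakk>0 < p; p < q\<rbrakk> \<Longrightarrow> \<exists>t. (gauss_map ^^ t) (real p / real q) = 0"
proof (induction q arbitrary: p rule: less_induct)
  case (less q)
  have "gauss_map (real p / real q) = frac (real q / real p)" by (simp add: gauss_map_def)
  also have "\<dots> = real (q mod p) / real p"
  proof -
    have "real q = real p * real (q div p) + real (q mod p)"
      by (metis mult_div_mod_eq of_nat_add of_nat_mult)
    thus ?thesis
      unfolding frac_def floor_divide_of_nat_eq using less.prems by (simp add: field_simps)
  qed
  finally have g: "gauss_map (real p / real q) = real (q mod p) / real p" .
  show ?case
  proof (cases "q mod p = 0")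
    case True
    thus ?thesis using g by (intro exI[of _ 1]) simp
  next
    case False
    then obtain t where "(gauss_map ^^ t) (real (q mod p) / real p) = 0"
      using less.IH[of p "q mod p"] less.prems by auto
    thus ?thesis using g by (intro exI[of _ "Suc t"]) (simp add: funpow_swap1)
  qed
qed

text \<open>For a point in all cylinders the prescribed tails form the Gauss orbit. They are
  positive, whereas the orbit of a rational reaches \<open>0\<close>.\<close>

lemma ex_unit_irrational_with_quotients:
  assumes b: "\<And>j. 1 \<le> j \<Longrightarrow> 1 \<le> b j"
  obtains x where "unit_irrational x" "\<And>j. 1 \<le> j \<Longrightarrow> partial_quotient x j = b j"
proof -
  obtain x where x: "x \<in> expansion_set b" using expansion_set_nonempty[of b] b by blast
  define y where "y = rec_nat x (\<lambda>t v. 1 / v - real (b (Suc t)))"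
  have y0: "y 0 = x" and yS: "y (Suc t) = 1 / y t - real (b (Suc t))" for t by (simp_all add: y_def)
  have mem: "y t \<in> expansion_set (\<lambda>j. b (t + j))" for t
  proof (induction t)
    case 0
    show ?case using x by (simp add: y0)
  next
    case (Suc t)
    show ?case using expansion_set_shift(2)[OF _ Suc] b by (simp add: yS)
  qed
  have pos: "0 < y t" for t
    using expansion_set_shift(1,3)[OF _ mem[of t]] b by fastforce
  \<comment> \<open>Closed cylinders may contain \<open>1\<close>; it is excluded because the
    following tail is positive.\<close>
  have lt1: "y t < 1" for t
  proof -
    have "1 < 1 / y t" using yS[of t] pos[of "Suc t"] b[of "Suc t"] by simp
    thus ?thesis using pos[of t] by simp
  qed
  have fl: "\<lfloor>1 / y t\<rfloor> = int (b (Suc t))" for t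
    using yS[of t] pos[of "Suc t"] lt1[of "Suc t"] by (intro floor_unique) simp_all
  have gy: "(gauss_map ^^ t) x = y t" for t
    by (induction t) (simp_all add: y0 yS gauss_map_def frac_def fl)
  show ?thesis
  proof
    show "unit_irrational x"
    proof
      show u: "x \<in> {0<..<1}" using pos[of 0] lt1[of 0] by (simp add: y0)
      show "x \<notin> \<rat>"
      proof
        assume "x \<in> \<rat>"
        then obtain p q where pq: "q \<noteq> 0" "\<bar>x\<bar> = real p / real q" by (rule Rats_abs_nat_div_natE)
        have xe: "x = real p / real q" using u pq(2) by simp
        have "0 < real p" "real p < real q" using u pq unfolding xe
          by (auto simp: zero_less_divide_iff divide_less_eq)
        hence "0 < p" "p < q" by simp_all
        then obtain t where "(gauss_map ^^ t) x = 0" using gauss_map_rational_terminates xe by blast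
        thus False using gy[of t] pos[of t] by simp
      qed
    qed
    show "partial_quotient x j = b j" if "1 \<le> j" for j
      using that fl[of "j - 1"] by (simp add: partial_quotient_def gy)
  qed
qed

section \<open>Slowly growing quotient sums with oscillating density\<close>

context
  fixes n :: nat
  assumes n: "5 \<le> n"
begin

lemma lev_cong:
  assumes "\<And>j. 1 \<le> j \<Longrightarrow> j \<le> t \<Longrightarrow> a j = b j"
  shows "lev1 n a t = lev1 n b t"
proof -
  have "cf_den a t = cf_den b t" "cf_den a (Suc t) = cf_den b (Suc t)"
    by (rule cf_den_cong; use assms in simp)+
  moreover have "cum_weight n a t = cum_weight n b t"
    unfolding cum_weight_def[OF n] using assms by (intro prod.cong) auto
  ultimately show ?thesis by (simp add: lev1_def[OF n])
qed

lemma ratio_cong: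
  assumes "\<And>j. 1 \<le> j \<Longrightarrow> j \<le> t \<Longrightarrow> a j = b j"
  shows "ratio a t = ratio b t"
  using cf_den_cong[of "Suc t" a b] partial_sum_cong[of t a b] assms by (simp add: ratio_def)

lemma excess_cong:
  assumes "\<And>j. 1 \<le> j \<Longrightarrow> j \<le> t \<Longrightarrow> a j = b j"
  shows "excess n a t = excess n b t"
  using partial_sum_cong[of t a b] assms by (simp add: excess_def[OF n])

text \<open>A step \<open>1\<close> yields a convex combination and the old \<open>lev1\<close>. The
  bound is independent of the length of the block of ones, which can thus be chosen
  afterwards.\<close>

lemma lev_ones_le:
  assumes "\<And>j. T < j \<Longrightarrow> a j = 1" "T \<le> t"
  shows "max (lev1 n a t) (lev2 n a t) \<le> max (lev1 n a T) (lev2 n a T)"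
  using assms(2)
proof (induction t rule: dec_induct)
  case (step t)
  have 1: "a (Suc t) = 1" using assms(1) step by simp
  show ?case
    using step.IH convex_golden_upper[OF n, of "lev1 n a t" "max (lev1 n a T) (lev2 n a T)" "lev2 n a t"]
    unfolding lev_step_1[OF n, of a t, OF 1] by simp
qed simp

section \<open>Stagewise construction of the oscillating sequence\<close>

context
  fixes \<psi> :: "nat \<Rightarrow> real"
  assumes mono: "mono_on {1..} \<psi>" and at_top: "filterlim \<psi> at_top sequentially"
begin

definition admissible :: "(nat \<Rightarrow> nat) \<Rightarrow> nat \<Rightarrow> bool" where
  "admissible a T \<longleftrightarrow> (\<forall>j\<ge>1. 1 \<le> a j \<and> a j \<le> n) \<and> (\<forall>j>T. a j = 1) \<and> (\<forall>t\<ge>1. excess n a t \<le> \<psi> t)"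

lemma admissible_extension:
  assumes adm: "admissible a T"
  obtains b T' where "admissible b T'" "T < T'" "\<And>j. j \<le> T \<Longrightarrow> b j = a j"
    "\<exists>u. T < u \<and> u \<le> T' \<and> K \<le> ratio b u" "ratio b T' \<le> 1"
proof -
  have a: "\<And>j. 1 \<le> j \<Longrightarrow> 1 \<le> a j \<and> a j \<le> n" and ones: "\<And>j. T < j \<Longrightarrow> a j = 1"
    and ex: "\<And>t. 1 \<le> t \<Longrightarrow> excess n a t \<le> \<psi> t"
    using adm unfolding admissible_def by auto
  note kb = kappa_bounds[OF n] and tp = tilt_pos[OF n]
  define c where "c = max 1 (max (lev1 n a T) (lev2 n a T))"
  define d where "d = real n + 1 - 2 * kappa n"
  have d: "0 < d" using kb by (simp add: d_def)
  \<comment> \<open>At excess \<open>M - d\<close> the factor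
    \<open>exp (- 2 * tilt n * (M - d))\<close> is \<open>1 / c ^ 2\<close>, enough to bring the
    ratio to \<open>1\<close>. Only \<open>a\<close> and \<open>T\<close> enter, so \<open>U\<close>
    can be chosen with \<open>M \<le> \<psi> U\<close>.\<close>
  define M where "M = d + ln c / tilt n"
  have M: "0 \<le> M" using d tp by (auto simp: M_def c_def intro!: add_nonneg_nonneg divide_nonneg_pos)
  have "\<forall>\<^sub>F t in sequentially. T < t \<and> 1 \<le> t \<and> M \<le> \<psi> t \<and> 0 \<le> - excess n a t \<and> K \<le> ratio a t"
    using at_top ratio_ones_at_top[OF n, of a T, OF a ones] excess_ones_unbounded[OF n, of T a, OF ones]
    by (intro eventually_conj eventually_gt_at_top eventually_ge_at_top) (simp_all add: filterlim_at_top del: neg_0_le_iff_le)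
  then obtain U where U: "T < U" "1 \<le> U" "M \<le> \<psi> U" "excess n a U \<le> 0" "K \<le> ratio a U"
    unfolding eventually_sequentially by (auto simp del: One_nat_def)
  define e where "e = excess n a U"
  \<comment> \<open>The largest number of pairs \<open>1, n\<close> keeping the excess at most
    \<open>M\<close>; it then exceeds \<open>M - d\<close>.\<close>
  define m where "m = nat \<lfloor>(M - e) / d\<rfloor>"
  have "0 \<le> (M - e) / d" using M U d by (simp add: e_def)
  hence mr: "real m \<le> (M - e) / d" "(M - e) / d < real m + 1" unfolding m_def by linarith+
  hence m: "e + real m * d \<le> M" "M - d < e + real m * d" using d by (simp_all add: field_simps)
  define b where "b = (\<lambda>i. if U < i \<and> i \<le> U + 2 * m \<and> even (i - U) then n else a i)"
  have ba: "b j = a j" if "j \<le> U" for j using that by (simp add: b_def)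
  have b_odd: "b (Suc (U + 2 * i)) = 1" for i
    using ones[of "Suc (U + 2 * i)"] U by (simp add: b_def)
  have b_even: "b (Suc (Suc (U + 2 * i))) = n" if "i < m" for i using that by (simp add: b_def)
  have b_ones: "b j = 1" if "U + 2 * m < j" for j using that ones U by (simp add: b_def)
  have pairs: "excess n b (U + 2 * i) = e + real i * d \<and> lev1 n b (U + 2 * i) = lev1 n a U" if "i \<le> m" for i
    using that
  proof (induction i)
    case 0
    show ?case using excess_cong[of U b a] lev_cong[of U b a] ba by (simp add: e_def)
  next
    case (Suc i)
    \<comment> \<open>The pair \<open>1, n\<close> is neutral: \<open>lev1\<close> passes into
      \<open>lev2\<close> at the \<open>1\<close> and back at the \<open>n\<close>.\<close>
    have "lev1 n b (Suc (Suc (U + 2 * i))) = lev2 n b (Suc (U + 2 * i))"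
      using Suc.prems by (intro lev1_step_n[OF n] b_even) simp
    also have "\<dots> = lev1 n b (U + 2 * i)"
      by (rule lev_step_1(2)[where a = b and t = "U + 2 * i", OF n b_odd])
    finally show ?case using Suc b_odd[of i] b_even[of i]
      by (simp add: excess_Suc[OF n] d_def algebra_simps)
  qed
  have exb: "excess n b t \<le> \<psi> t" if t: "1 \<le> t" for t
  proof -
    consider "t \<le> U" | "U \<le> t" "t \<le> U + 2 * m" | "U + 2 * m \<le> t" by linarith
    thus ?thesis
    proof cases
      case 1
      thus ?thesis using excess_cong[of t b a] ba ex[OF t] by simp
    next
      case 2
      have "excess n b t \<le> M"
      proof (cases "even (t - U)")
        case True
        then obtain i where "t - U = 2 * i" by (elim evenE)
        hence i: "t = U + 2 * i" "i \<le> m" using 2 by auto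
        have "real i * d \<le> real m * d" using i d by simp
        thus ?thesis using pairs[OF i(2)] m(1) unfolding i(1) by linarith
      next
        case False
        then obtain i where "t - U = 2 * i + 1" by (elim oddE)
        hence i: "t = Suc (U + 2 * i)" "i \<le> m" using 2 by auto
        have "real i * d \<le> real m * d" using i d by simp
        moreover have "excess n b t = excess n b (U + 2 * i) + (1 - kappa n)"
          unfolding i(1) excess_Suc[OF n] b_odd by simp
        ultimately show ?thesis using pairs[OF i(2)] m(1) kb by linarith
      qed
      also have "M \<le> \<psi> U" by (rule U)
      also have "\<psi> U \<le> \<psi> t" using 2 U by (intro mono_onD[OF mono]) auto
      finally show ?thesis .
    next
      case 3
      have "excess n b t = excess n b (U + 2 * m) - (kappa n - 1) * real (t - (U + 2 * m))"
        by (rule excess_ones[OF n b_ones 3])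
      also have "\<dots> \<le> M" using pairs[of m] m(1) kb by (simp add: diff_le_eq add_increasing2)
      also have "M \<le> \<psi> U" by (rule U)
      also have "\<psi> U \<le> \<psi> t" using 3 U by (intro mono_onD[OF mono]) auto
      finally show ?thesis .
    qed
  qed
  show ?thesis
  proof
    show "admissible b (U + 2 * m)"
      unfolding admissible_def using exb b_ones a n by (auto simp: b_def)
    show "T < U + 2 * m" using U by simp
    show "b j = a j" if "j \<le> T" for j using that U ba by simp
    have "ratio b U = ratio a U" using ba by (intro ratio_cong) simp
    thus "\<exists>u. T < u \<and> u \<le> U + 2 * m \<and> K \<le> ratio b u" using U by (intro exI[of _ U]) simp
    have "lev1 n a U \<le> max (lev1 n a U) (lev2 n a U)" by simp
    also have "\<dots> \<le> max (lev1 n a T) (lev2 n a T)" using ones U by (intro lev_ones_le) auto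
    also have "\<dots> \<le> c" by (simp add: c_def)
    finally have "lev1 n a U \<le> c" .
    moreover have "0 \<le> lev1 n a U" by (rule lev1_nonneg[OF n])
    ultimately have l: "lev1 n a U ^ 2 \<le> c ^ 2" by (intro power_mono)
    have "c ^ 2 = exp (2 * ln c)" by (simp add: c_def exp_double)
    also have "2 * ln c = 2 * tilt n * (M - d)" using tp by (simp add: M_def)
    finally have c2: "c ^ 2 = exp (2 * tilt n * (M - d))" .
    have "ratio b (U + 2 * m) \<le> lev1 n a U ^ 2 * exp (- 2 * tilt n * (e + real m * d))"
      using ratio_le[OF n, of b "U + 2 * m"] pairs[of m] by simp
    also have "\<dots> \<le> exp (2 * tilt n * (M - d)) * exp (- 2 * tilt n * (M - d))"
      using l m(2) tp unfolding c2 by (intro mult_mono) auto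
    also have "\<dots> = 1" by (simp flip: exp_add)
    finally show "ratio b (U + 2 * m) \<le> 1" .
  qed
qed

text \<open>Diagonal limit of repeated extensions, the \<open>k\<close>-th reaching a ratio of at
  least \<open>k\<close>. Ratio and excess at \<open>t\<close> depend only on entries up to
  \<open>t\<close>, so the limit inherits all bounds.\<close>

lemma ex_oscillating_sequence:
  assumes "1 \<le> kappa n + \<psi> 1"
  obtains a where "\<And>j. 1 \<le> j \<Longrightarrow> 1 \<le> a j \<and> a j \<le> n" "\<And>t. 1 \<le> t \<Longrightarrow> excess n a t \<le> \<psi> t"
    "\<exists>\<^sub>F t in sequentially. ratio a t \<le> 1" "\<And>K. \<exists>\<^sub>F t in sequentially. K \<le> ratio a t"
proof -
  note kb = kappa_bounds[OF n]
  define good where "good = (\<lambda>k s s'. snd s < snd s' \<and> (\<forall>j\<le>snd s. fst s' j = fst s j) \<and>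
    (\<exists>u. snd s < u \<and> u \<le> snd s' \<and> real k \<le> ratio (fst s') u) \<and> ratio (fst s') (snd s') \<le> (1::real))"
  have "\<exists>f. \<forall>k. (case f k of (a, T) \<Rightarrow> admissible a T) \<and> good k (f k) (f (Suc k))"
  proof (rule dependent_nat_choice)
    \<comment> \<open>The excess of the all-ones sequence decreases from \<open>1 - kappa n\<close>,
      so the condition on \<open>\<psi> 1\<close> covers every \<open>t\<close>.\<close>
    have "excess n (\<lambda>_. 1) t \<le> \<psi> t" if "1 \<le> t" for t
    proof -
      have "excess n (\<lambda>_. 1) t = (1 - kappa n) * real t"
        by (simp add: excess_def[OF n] partial_sum_def algebra_simps)
      also have "\<dots> \<le> (1 - kappa n) * 1" using that kb by (intro mult_left_mono_neg) auto
      also have "\<dots> \<le> \<psi> 1" using assms by simp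
      also have "\<psi> 1 \<le> \<psi> t" using that by (intro mono_onD[OF mono]) auto
      finally show ?thesis .
    qed
    hence "admissible (\<lambda>_. 1) 0" using n by (simp add: admissible_def)
    thus "\<exists>s. case s of (a, T) \<Rightarrow> admissible a T" by blast
    fix s :: "(nat \<Rightarrow> nat) \<times> nat" and k
    assume "case s of (a, T) \<Rightarrow> admissible a T"
    hence "admissible (fst s) (snd s)" by (simp add: case_prod_beta)
    then obtain b T' where "admissible b T'" "snd s < T'" "\<And>j. j \<le> snd s \<Longrightarrow> b j = fst s j"
      "\<exists>u. snd s < u \<and> u \<le> T' \<and> real k \<le> ratio b u" "ratio b T' \<le> 1"
      by (rule admissible_extension[where K = "real k"]) blast
    thus "\<exists>s'. (case s' of (a, T) \<Rightarrow> admissible a T) \<and> good k s s'"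
      by (intro exI[of _ "(b, T')"]) (simp add: good_def)
  qed
  then obtain f where f: "\<And>k. case f k of (a, T) \<Rightarrow> admissible a T" "\<And>k. good k (f k) (f (Suc k))"
    by (elim exE) (meson that)
  define A where "A = (\<lambda>k. fst (f k))"
  define T where "T = (\<lambda>k. snd (f k))"
  have adm: "admissible (A k) (T k)" for k
    using f(1)[of k] by (simp add: A_def T_def case_prod_beta)
  have step: "T k < T (Suc k)" "\<And>j. j \<le> T k \<Longrightarrow> A (Suc k) j = A k j"
    "\<exists>u. T k < u \<and> u \<le> T (Suc k) \<and> real k \<le> ratio (A (Suc k)) u" "ratio (A (Suc k)) (T (Suc k)) \<le> 1" for k
    using f(2)[of k] by (simp_all add: good_def A_def T_def)
  have sm: "strict_mono T" by (rule strict_monoI_Suc) (rule step)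
  have T_ge: "k \<le> T k" for k by (rule strict_mono_imp_increasing[OF sm])
  have agree: "A l j = A k j" if "k \<le> l" "j \<le> T k" for k l j
    using that
  proof (induction l rule: dec_induct)
    case (step l)
    have "T k \<le> T l" using step sm by (simp add: strict_mono_less_eq)
    thus ?case using step \<open>j \<le> T k\<close> \<open>\<And>k j. j \<le> T k \<Longrightarrow> A (Suc k) j = A k j\<close> by simp
  qed simp
  \<comment> \<open>Entry \<open>j\<close> is final at stage \<open>j\<close>, as
    \<open>j \<le> T j\<close>.\<close>
  define b where "b = (\<lambda>j. A j j)"
  have bA: "b j = A k j" if "j \<le> T k" for j k
    using agree[of k j j] agree[of j k j] that T_ge[of j] unfolding b_def by (cases "k \<le> j") auto
  have rb: "ratio b t = ratio (A k) t" if "t \<le> T k" for t k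
    using that bA by (intro ratio_cong) auto
  show ?thesis
  proof
    show "1 \<le> b j \<and> b j \<le> n" if "1 \<le> j" for j
      using adm[of j] that unfolding admissible_def b_def by blast
    show "excess n b t \<le> \<psi> t" if "1 \<le> t" for t
    proof -
      have "excess n b t = excess n (A t) t" using bA[of _ t] T_ge[of t] by (intro excess_cong) auto
      thus ?thesis using adm[of t] that unfolding admissible_def by auto
    qed
    show "\<exists>\<^sub>F t in sequentially. ratio b t \<le> 1"
      unfolding frequently_sequentially
    proof
      fix N
      have "N \<le> T (Suc N)" using T_ge[of "Suc N"] by simp
      thus "\<exists>t\<ge>N. ratio b t \<le> 1" using step(4)[of N] rb[of "T (Suc N)" "Suc N"] by auto
    qed
    show "\<exists>\<^sub>F t in sequentially. K \<le> ratio b t" for K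
      unfolding frequently_sequentially
    proof
      fix N
      define k where "k = max N (nat \<lceil>K\<rceil>)"
      obtain u where u: "T k < u" "u \<le> T (Suc k)" "real k \<le> ratio (A (Suc k)) u"
        using step(3) by blast
      have "N \<le> u" using u T_ge[of k] by (simp add: k_def)
      moreover have "K \<le> real k" unfolding k_def by linarith
      ultimately show "\<exists>t\<ge>N. K \<le> ratio b t" using u rb[of u "Suc k"] by (intro exI[of _ u]) auto
    qed
  qed
qed

end

end

text \<open>In the second part \<open>1 \<le> kappa n + \<psi> 1\<close> is forced by the conclusion
  at \<open>t = 1\<close>, because the first partial quotient is at least \<open>1\<close>.\<close>

theorem theorem5:
  shows "(\<forall>n\<ge>5. \<forall>x\<in>bounded_quotients n.
            (\<exists>C. \<forall>t\<ge>1. real (quotient_sum x t) \<le> kappa n * real t + C)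
            \<longrightarrow> has_extended_derivative question_mark x \<infinity>)
       \<and> (\<forall>\<psi> :: nat \<Rightarrow> real. \<forall>n\<ge>5.
            mono_on {1..} \<psi> \<and> filterlim \<psi> at_top sequentially \<and> 1 \<le> kappa n + \<psi> 1
            \<longrightarrow> (\<exists>x\<in>bounded_quotients n.
                  \<not> extended_differentiable question_mark x
                  \<and> (\<forall>t\<ge>1. real (quotient_sum x t) \<le> kappa n * real t + \<psi> t)))"
proof (intro conjI allI ballI impI; (elim exE conjE)?)
  fix n x C
  assume n: "5 \<le> (n::nat)" and x: "x \<in> bounded_quotients n"
    and C: "\<forall>t\<ge>1. real (quotient_sum x t) \<le> kappa n * real t + C"
  interpret unit_irrational x using x by unfold_locales (auto simp: bounded_quotients_def)
  have le: "a j \<le> n" if "1 \<le> j" for j using x that by (auto simp: bounded_quotients_def)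
  have "filterlim (ratio a) at_top sequentially"
  proof (rule ratio_at_top[OF n])
    show "1 \<le> a j \<and> a j \<le> n" if "1 \<le> j" for j using a_ge_1 le that by blast
    show "excess n a t \<le> C" if "1 \<le> t" for t
      using C that by (fastforce simp: excess_def[OF n] quotient_sum_eq)
  qed
  thus "has_extended_derivative question_mark x \<infinity>"
    by (intro question_mark_derivative_infinite[of n] le)
next
  fix \<psi> :: "nat \<Rightarrow> real" and n :: nat
  assume n: "5 \<le> n" and \<psi>: "mono_on {1..} \<psi>" "filterlim \<psi> at_top sequentially" "1 \<le> kappa n + \<psi> 1"
  obtain b where b: "\<And>j. 1 \<le> j \<Longrightarrow> 1 \<le> b j \<and> b j \<le> n" "\<And>t. 1 \<le> t \<Longrightarrow> excess n b t \<le> \<psi> t"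
    and osc: "\<exists>\<^sub>F t in sequentially. ratio b t \<le> 1" "\<And>K. \<exists>\<^sub>F t in sequentially. K \<le> ratio b t"
    by (rule ex_oscillating_sequence[OF n \<psi>]) blast
  obtain x where x: "unit_irrational x" "\<And>j. 1 \<le> j \<Longrightarrow> partial_quotient x j = b j"
    using ex_unit_irrational_with_quotients[of b] b(1) by blast
  interpret unit_irrational x by (rule x)
  have r: "ratio a = ratio b" by (rule ext, rule ratio_cong) (use x in auto)
  have "\<not> extended_differentiable question_mark x"
    by (rule not_extended_differentiable[of n]) (use x b osc r in auto)
  moreover have "x \<in> bounded_quotients n"
    using unit irrational x(2) b(1) by (auto simp: bounded_quotients_def)
  moreover have "real (quotient_sum x t) \<le> kappa n * real t + \<psi> t" if "1 \<le> t" for t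
  proof -
    have "excess n a t = excess n b t" by (rule excess_cong[OF n]) (use x in auto)
    thus ?thesis using b(2)[OF that] by (simp add: excess_def[OF n] quotient_sum_eq)
  qed
  ultimately show "\<exists>x\<in>bounded_quotients n. \<not> extended_differentiable question_mark x
      \<and> (\<forall>t\<ge>1. real (quotient_sum x t) \<le> kappa n * real t + \<psi> t)" by blast
qed

end
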